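(* Let $r\ge 1$ be an integer and $b\ge 1$ a squarefree integer such that $P(X)=X^3+3rbX-b$ is monogenic, let $\theta$ be the real zero of $P(X)$, and let $L=\mathbb{Q}(\theta)$ be the simply real cubic number field generated by it. Let $\ell$ be the primitive period length of the Voronoi algorithm for the maximal order $\mathcal{O}_L$. For $b\ge 2$, put $L(b)=\lceil b/3\rceil$. Then $\ell$ takes only the two values $2$ and $3$: (a) if $r<L(b)$, then $\ell=2$, the chain $\mathrm{Min}(\mathcal{O}_L)$ is an $\mathrm{M}1$-chain, and $$\nu^0(1)=1,\quad \nu^1(1)=\theta,\quad \nu^2(1)=1-3r\theta=\varepsilon_0,$$ with norms $1$, $\mathrm{N}(\theta)=b$, $\mathrm{N}(\varepsilon_0)=1$, where $\theta$ is a differential principal factor and $\varepsilon_0$ is the fundamental unit; (b) if $r\ge L(b)$, then $\ell=3$, the chain $\mathrm{Min}(\mathcal{O}_L)$ is an $\mathrm{M}2$-chain, and $$\nu^0(1)=1,\quad \nu^1(1)=\theta,\quad \nu^2(1)=\theta^2,\quad \nu^3(1)=1-3r\theta=\varepsilon_0,$$ with norms $1$, $\mathrm{N}(\theta)=b$, $\mathrm{N}(\theta^2)=b^2$, $\mathrm{N}(\varepsilon_0)=1$, where $\theta$ and $\theta^2$ are differential principal factors and $\varepsilon_0$ is the fundamental unit. For $b=1$, the period length takes the minimal value $\ell=1$ and the chain is an $\mathrm{M}0$-chain with $\nu^0(1)=1$ and $\nu^1(1)=\theta=\varepsilon_0$ the fundamental unit (and $\nu^2(1)=\theta^2=\varepsilon_0^2$,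 $\nu^3(1)=1-3r\theta=\varepsilon_0^3$), all of norm $1$. In the cases with $\ell\in\{2,3\}$, all non-unitary lattice minima are differential principal factors.
   Context: $P$ is monogenic if it is irreducible and $\mathbb{Z}[\theta]=\mathcal{O}_L$. For $\alpha\in L\subset\mathbb{R}$ let $\alpha',\alpha''$ be the two complex conjugates, so $\alpha'\alpha''=|\alpha'|^2$; $\mathrm{N}=\mathrm{N}_{L/\mathbb{Q}}$. A lattice minimum of $\mathcal{O}_L$ is an element $\alpha\in\mathcal{O}_L$, $\alpha>0$, such that no non-zero $\nu\in\mathcal{O}_L$ satisfies $|\nu|<\alpha$ and $\nu'\nu''<\alpha'\alpha''$; $\mathrm{Min}(\mathcal{O}_L)$ is the set of these. For $\alpha\in\mathrm{Min}(\mathcal{O}_L)$, $\nu(\alpha)$ denotes the lattice minimum with the largest real value smaller than $\alpha$; $\nu$ is a bijection and $\mathrm{Min}(\mathcal{O}_L)=\{\nu^i(1):i\in\mathbb{Z}\}$ (the Voronoi chain). The group $U_L^+$ of positive units acts on $\mathrm{Min}(\mathcal{O}_L)$ by multiplication; the primitive period length $\ell$ of the Voronoi algorithm is the number of orbits, equivalently the least $\ell\ge 1$ such that $\nu^{\ell}(1)$ is a unit (which is then the fundamental unit in $(0,1)$). A fundamental unit is an $\varepsilon_0$ with $U_L=\langle -1,\varepsilon_0\rangle$. A differential principal factor is here a non-unit $\alpha\in\mathcal{O}_L$ generating an ambiguous ideal, i.e. $\alpha^3/\mathrm{N}(\alpha)$ is a unit, and such that $\alpha\mathcal{O}_L$ is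 not generated by a rational number. The chain is an $\mathrm{M}2$-, $\mathrm{M}1$-, $\mathrm{M}0$-chain if $\mathrm{Min}(\mathcal{O}_L)$ contains exactly $2$, $1$, $0$ orbits of such elements, respectively. Note that $L$ is the field while $L(b)$ is an integer bound. *)

theory Defs
  imports
    "HOL-Analysis.Analysis"
    "HOL-Computational_Algebra.Computational_Algebra"
begin

definition is_real_subfield :: "real set \<Rightarrow> bool" where
  "is_real_subfield F \<longleftrightarrow> 0 \<in> F \<and> 1 \<in> F \<and>
     (\<forall>x\<in>F. \<forall>y\<in>F. x + y \<in> F \<and> x * y \<in> F) \<and> (\<forall>x\<in>F. - x \<in> F \<and> inverse x \<in> F)"

definition rat_adjoin :: "real \<Rightarrow> real set" where
  "rat_adjoin \<theta> = \<Inter> {F. is_real_subfield F \<and> \<theta> \<in> F}"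

definition int_adjoin :: "real \<Rightarrow> real set" where
  "int_adjoin \<theta> = range (\<lambda>p :: int poly. poly (map_poly of_int p) \<theta>)"

definition ring_of_integers :: "real set \<Rightarrow> real set" where
  "ring_of_integers K = {x \<in> K. algebraic_int x}"

definition monogenic :: "int poly \<Rightarrow> real \<Rightarrow> bool" where
  "monogenic P \<theta> \<longleftrightarrow>
     irreducible (map_poly of_int P :: rat poly) \<and>
     int_adjoin \<theta> = ring_of_integers (rat_adjoin \<theta>)"

text \<open>A number field is represented by its carrier \<open>K\<close> inside the reals. Embeddings are required
  to be extensional, so that there are exactly as many of them as the degree of \<open>K\<close>.\<close>

definition embeddings :: "real set \<Rightarrow> (real \<Rightarrow> complex) set" where
  "embeddings K = {\<sigma>. \<sigma> \<in> extensional K \<and> \<sigma> 1 = 1 \<and>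
     (\<forall>x\<in>K. \<forall>y\<in>K. \<sigma> (x + y) = \<sigma> x + \<sigma> y \<and> \<sigma> (x * y) = \<sigma> x * \<sigma> y)}"

text \<open>The products below are real numbers because complex conjugation permutes the embeddings;
  \<open>Re\<close> only changes the type.\<close>

definition field_norm :: "real set \<Rightarrow> real \<Rightarrow> real" where
  "field_norm K \<alpha> = Re (\<Prod>\<sigma>\<in>embeddings K. \<sigma> \<alpha>)"

text \<open>The product of the conjugates of \<open>\<alpha>\<close> other than \<open>\<alpha>\<close> itself; in a cubic field with two
  complex embeddings this is \<open>\<alpha>' * \<alpha>'' = \<bar>\<alpha>'\<bar>\<^sup>2\<close>.\<close>

definition conj_prod :: "real set \<Rightarrow> real \<Rightarrow> real" where
  "conj_prod K \<alpha> = Re (\<Prod>\<sigma>\<in>embeddings K - {restrict complex_of_real K}. \<sigma> \<alpha>)"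

definition lattice_minima :: "real set \<Rightarrow> real set" where
  "lattice_minima K = {\<alpha> \<in> ring_of_integers K. \<alpha> > 0 \<and>
     \<not> (\<exists>\<nu>\<in>ring_of_integers K. \<nu> \<noteq> 0 \<and> \<bar>\<nu>\<bar> < \<alpha> \<and> conj_prod K \<nu> < conj_prod K \<alpha>)}"

definition next_minimum :: "real set \<Rightarrow> real \<Rightarrow> real" where
  "next_minimum K \<alpha> = (GREATEST \<beta>. \<beta> \<in> lattice_minima K \<and> \<beta> < \<alpha>)"

definition unit_group :: "real set \<Rightarrow> real set" where
  "unit_group K = {u \<in> ring_of_integers K. \<exists>v\<in>ring_of_integers K. u * v = 1}"

definition fundamental_unit :: "real set \<Rightarrow> real \<Rightarrow> bool" where
  "fundamental_unit K \<epsilon> \<longleftrightarrow>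
     unit_group K = {s * \<epsilon> powi k | s k. s \<in> {1, -1}}"

definition unit_orbit :: "real set \<Rightarrow> real \<Rightarrow> real set" where
  "unit_orbit K \<alpha> = {u * \<alpha> | u. u \<in> unit_group K \<and> u > 0}"

definition period_length :: "real set \<Rightarrow> nat" where
  "period_length K = card (unit_orbit K ` lattice_minima K)"

definition principal_ideal :: "real set \<Rightarrow> real \<Rightarrow> real set" where
  "principal_ideal K \<alpha> = {\<alpha> * x | x. x \<in> ring_of_integers K}"

definition diff_principal_factor :: "real set \<Rightarrow> real \<Rightarrow> bool" where
  "diff_principal_factor K \<alpha> \<longleftrightarrow>
     \<alpha> \<in> ring_of_integers K \<and> \<alpha> \<notin> unit_group K \<and>
     \<alpha> ^ 3 / field_norm K \<alpha> \<in> unit_group K \<and>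
     \<not> (\<exists>q\<in>\<rat>. principal_ideal K \<alpha> = principal_ideal K q)"

text \<open>Finiteness is required explicitly because \<open>card\<close> of an infinite set is 0.\<close>

definition M_chain :: "nat \<Rightarrow> real set \<Rightarrow> bool" where
  "M_chain k K \<longleftrightarrow>
     (let Orb = unit_orbit K ` {\<alpha> \<in> lattice_minima K. diff_principal_factor K \<alpha>}
      in finite Orb \<and> card Orb = k)"

end

theory Submission
  imports Defs
begin

text \<open>
  Write \<open>p = 3rb\<close>, \<open>\<epsilon> = 1 - 3r\<theta>\<close> and \<open>\<phi> = \<theta>\<^sup>2 / b\<close>.  The equation of \<open>\<theta>\<close> says
  \<open>\<theta>\<^sup>3 = b\<epsilon>\<close> and \<open>1/\<theta> = 3r + \<phi>\<close>.  Monogenicity makes \<open>1, \<theta>, \<theta>\<^sup>2\<close> an integral basis, so \<open>\<epsilon>\<close>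
  is a unit and \<open>\<theta>\<close> generates an ambiguous ideal of norm \<open>b\<close>.  The whole statement follows once
  the lattice minima in one period \<open>(\<epsilon>, 1]\<close> are known: multiplication by \<open>\<epsilon>\<close> permutes the minima,
  every positive unit is a minimum of norm 1, and orbits of different norm are different.  This
  reduction is the lemma \<open>voronoi_chain\<close>.

  Consecutive minima \<open>\<beta> < \<alpha>\<close> are recognised by \<open>gap_criterion\<close>: it is enough that \<open>\<plusminus>\<beta>\<close> are the only
  non-zero integers \<open>\<nu>\<close> with \<open>\<bar>\<nu>\<bar> < \<alpha>\<close> and \<open>|\<nu>'|\<^sup>2 \<le> |\<beta>'|\<^sup>2\<close>.  Dividing by \<open>\<alpha>\<close>, a power of
  \<open>\<theta>\<close>, turns this into a search for the points with \<open>\<bar>\<mu>\<bar> < 1\<close> and small \<open>|\<mu>'|\<close> in one of the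
  lattices spanned by \<open>1, \<theta>, \<theta>\<^sup>2\<close>, by \<open>1, \<theta>, \<phi>\<close>, or by \<open>1, \<theta>/b, \<phi>\<close>.  In each of them the third
  basis vector has a conjugate that is large against the admitted bound or close to it, while
  the imaginary part of the conjugate controls the second coordinate, so that only coefficients
  of absolute value at most one survive and can be inspected one by one.

  The dichotomy arises in the lattice \<open>1, \<theta>, \<phi>\<close>, where \<open>|\<theta>'|\<^sup>2 = b/\<theta>\<close> competes with
  \<open>|\<phi>'|\<^sup>2 = 1/\<theta>\<^sup>2\<close>.  If \<open>b\<theta> > 1\<close>, which means \<open>b > 3r\<close>, then \<open>\<phi>\<close> wins and the minimum after
  \<open>\<theta>\<close> is \<open>\<theta>\<phi> = \<epsilon>\<close>.  If \<open>2 \<le> b \<le> 3r\<close>, then \<open>\<theta>\<close> wins, the next minimum is \<open>\<theta>\<^sup>2\<close>, and only then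
  comes \<open>\<epsilon>\<close>.  For \<open>b = 1\<close> the three lattices coincide, \<open>\<theta>\<close> is itself a unit, and the chain
  consists of its powers.
\<close>

section \<open>Real cubic fields generated by a root of a depressed cubic\<close>

text \<open>The same rational coordinates are evaluated at the real root and at the complex roots of a
  cubic, hence the polymorphic argument.\<close>

definition quad :: "rat \<times> rat \<times> rat \<Rightarrow> 'a::field_char_0 \<Rightarrow> 'a" where
  "quad t w = (case t of (x, y, z) \<Rightarrow> of_rat x + of_rat y * w + of_rat z * w\<^sup>2)"

lemma quad_add: "quad (x, y, z) w + quad (x', y', z') w = quad (x + x', y + y', z + z') w"
  by (simp add: quad_def of_rat_add algebra_simps)

lemma quad_diff: "quad (x, y, z) w - quad (x', y', z') w = quad (x - x', y - y', z - z') w"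
  by (simp add: quad_def of_rat_diff algebra_simps)

lemma quad_of_rat: "quad (x, 0, 0) w = of_rat x"
  by (simp add: quad_def)

lemma quad_of_real: "quad t (complex_of_real w) = of_real (quad t w)"
proof -
  have "of_rat x = complex_of_real (of_rat x)" for x
    by (cases x) (simp add: of_rat_rat)
  then show ?thesis by (cases t) (simp add: quad_def)
qed

lemma quad_cnj: "quad t (cnj w) = cnj (quad t w)"
proof -
  have "cnj (of_rat x) = of_rat x" for x
    by (cases x) (simp add: of_rat_rat)
  then show ?thesis by (cases t) (simp add: quad_def)
qed

lemma is_real_subfield_of_rat:
  assumes "is_real_subfield F"
  shows "of_rat a \<in> F"
proof -
  have F: "0 \<in> F" "1 \<in> F" "\<And>x y. x \<in> F \<Longrightarrow> y \<in> F \<Longrightarrow> x + y \<in> F"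
    "\<And>x y. x \<in> F \<Longrightarrow> y \<in> F \<Longrightarrow> x * y \<in> F" "\<And>x. x \<in> F \<Longrightarrow> - x \<in> F"
    "\<And>x. x \<in> F \<Longrightarrow> inverse x \<in> F"
    using assms unfolding is_real_subfield_def by blast+
  have nat: "of_nat n \<in> F" for n by (induction n) (auto intro: F)
  have int: "of_int k \<in> F" for k by (cases k) (use nat F in \<open>auto simp del: of_nat_Suc\<close>)
  show ?thesis
  proof (cases a)
    case (Fract m n)
    then have "of_rat a = (of_int m * inverse (of_int n) :: real)"
      by (simp add: of_rat_rat divide_inverse)
    then show ?thesis using F int by metis
  qed
qed

locale depressed_cubic =
  fixes p q :: int and \<theta> :: real
  assumes p_pos: "p > 0"
    and root: "\<theta> ^ 3 = q - p * \<theta>"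
    and irreducible_rat: "irreducible (map_poly of_int [:- q, p, 0, 1:] :: rat poly)"
begin

text \<open>Products are reduced modulo the cubic equation, so the result holds at every root, in every
  field. Multiplicativity of the embeddings comes from comparing two instances of this formula.\<close>

lemma quad_mult:
  fixes w :: "'a::field_char_0"
  assumes w: "w ^ 3 = of_int q - of_int p * w"
  shows "quad (x, y, z) w * quad (x', y', z') w =
    quad (x * x' + of_int q * (y * z' + z * y'),
      x * y' + y * x' - of_int p * (y * z' + z * y') + of_int q * (z * z'),
      x * z' + y * y' + z * x' - of_int p * (z * z')) w"
proof -
  have w2: "w * w\<^sup>2 = of_int q - of_int p * w" 
    unfolding w[symmetric] by (simp add: power2_eq_square power3_eq_cube)
  have w4: "w\<^sup>2 * w\<^sup>2 = of_int q * w - of_int p * w\<^sup>2"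
  proof -
    have "w\<^sup>2 * w\<^sup>2 = w * (w * w\<^sup>2)" by (simp add: power2_eq_square)
    then show ?thesis unfolding w2 by (simp add: power2_eq_square algebra_simps)
  qed
  have "quad (x, y, z) w * quad (x', y', z') w =
      of_rat x * of_rat x' + (of_rat x * of_rat y' + of_rat y * of_rat x') * w
      + (of_rat x * of_rat z' + of_rat y * of_rat y' + of_rat z * of_rat x') * w\<^sup>2
      + (of_rat y * of_rat z' + of_rat z * of_rat y') * (w * w\<^sup>2)
      + of_rat z * of_rat z' * (w\<^sup>2 * w\<^sup>2)"
    by (simp add: quad_def algebra_simps power2_eq_square)
  also have "\<dots> = quad (x * x' + of_int q * (y * z' + z * y'),
      x * y' + y * x' - of_int p * (y * z' + z * y') + of_int q * (z * z'),
      x * z' + y * y' + z * x' - of_int p * (z * z')) w"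
    unfolding w2 w4
    by (simp add: quad_def of_rat_add of_rat_diff of_rat_mult algebra_simps)
  finally show ?thesis .
qed

text \<open>A non-zero rational polynomial of least degree vanishing at \<open>\<theta>\<close> divides the irreducible cubic,
  hence has degree 3; so \<open>1, \<theta>, \<theta>\<^sup>2\<close> are linearly independent over the rationals.\<close>

lemma quad_root_eq_0:
  assumes "quad (x, y, z) \<theta> = 0"
  shows "x = 0 \<and> y = 0 \<and> z = 0"
proof (rule ccontr)
  assume nz: "\<not> ?thesis"
  define F where "F = (map_poly of_int [:- q, p, 0, 1:] :: rat poly)"
  have Fe: "F = [:of_int (- q), of_int p, 0, 1:]" by (simp add: F_def map_poly_pCons)
  define E where "E X = poly (map_poly of_rat X) \<theta>" for X
  have E_pCons: "E (pCons a X) = of_rat a + \<theta> * E X" for a X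
    by (cases "a = 0 \<and> X = 0") (auto simp: E_def map_poly_pCons)
  have E_0: "E 0 = 0" by (simp add: E_def)
  have E_add: "E (X + Y) = E X + E Y" for X Y
    by (induction X Y rule: poly_induct2) (simp_all add: E_pCons E_0 of_rat_add algebra_simps)
  have E_smult: "E (smult a X) = of_rat a * E X" for a X
    by (induction X) (simp_all add: E_pCons E_0 of_rat_mult algebra_simps)
  have E_mult: "E (X * Y) = E X * E Y" for X Y
    by (induction X) (simp_all add: E_pCons E_0 E_add E_smult algebra_simps)
  have E_F: "E F = 0" using root by (simp add: Fe E_pCons E_0 of_rat_minus power3_eq_cube algebra_simps)
  have "E [:x, y, z:] = 0"
    using assms by (simp add: quad_def E_pCons E_0 power2_eq_square algebra_simps)
  moreover have "[:x, y, z:] \<noteq> 0" using nz by auto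
  ultimately obtain G where G: "G \<noteq> 0" "E G = 0"
    and min: "\<And>H. H \<noteq> 0 \<Longrightarrow> E H = 0 \<Longrightarrow> degree G \<le> degree H"
    using ex_has_least_nat[of "\<lambda>H. H \<noteq> 0 \<and> E H = 0" "[:x, y, z:]" degree] by auto
  have "degree G \<le> 2"
  proof -
    have "degree [:x, y, z:] \<le> 2" by simp
    then show ?thesis using min[of "[:x, y, z:]"] \<open>E [:x, y, z:] = 0\<close> \<open>[:x, y, z:] \<noteq> 0\<close> by simp
  qed
  have "E F = E (F div G) * E G + E (F mod G)" unfolding E_mult[symmetric] E_add[symmetric] by simp
  then have "E (F mod G) = 0" using E_F G by simp
  then have "F mod G = 0" using min[of "F mod G"] degree_mod_less[OF G(1), of F] by force
  then have "G dvd F" by auto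
  then consider "F dvd G" | "is_unit G" using irreducible_rat irreducibleD'[of F G] F_def by auto
  then show False
  proof cases
    case 1
    then have "degree F \<le> degree G" using G by (simp add: dvd_imp_degree_le)
    then show False using \<open>degree G \<le> 2\<close> by (simp add: Fe)
  next
    case 2
    then obtain c where "G = [:c:]" by (auto simp: is_unit_poly_iff)
    then show False using G by (simp add: E_pCons E_0)
  qed
qed

lemma quad_inject: "quad s \<theta> = quad t \<theta> \<longleftrightarrow> s = t"
proof
  obtain x y z x' y' z' where st: "s = (x, y, z)" "t = (x', y', z')" by (metis prod_cases3)
  assume "quad s \<theta> = quad t \<theta>"
  then have "quad (x - x', y - y', z - z') \<theta> = 0" using quad_diff[of x y z \<theta> x' y' z'] by (simp add: st)
  then show "s = t" using quad_root_eq_0 st by fastforce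
qed simp

text \<open>The squared modulus \<open>|x + y\<theta>' + z\<theta>'\<^sup>2|\<^sup>2\<close> for a non-real root \<open>\<theta>'\<close>, split into the squares of the
  real and the imaginary part; \<open>\<theta>'\<close> has real part \<open>-\<theta>/2\<close> and squared imaginary part \<open>p + 3\<theta>\<^sup>2/4\<close>.\<close>

definition conj_form :: "real \<Rightarrow> real \<Rightarrow> real \<Rightarrow> real" where
  "conj_form x y z = (x - y * \<theta> / 2 - z * (p + \<theta>\<^sup>2 / 2))\<^sup>2 + (p + 3 * \<theta>\<^sup>2 / 4) * (y - z * \<theta>)\<^sup>2"

text \<open>Coordinates of the product of the two complex conjugates of \<open>x + y\<theta> + z\<theta>\<^sup>2\<close>, which lies in the
  real field again: the squared modulus above, reduced modulo the cubic.\<close>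

definition adjugate :: "rat \<times> rat \<times> rat \<Rightarrow> rat \<times> rat \<times> rat" where
  "adjugate t = (case t of (x, y, z) \<Rightarrow>
    (x\<^sup>2 + of_int p * y\<^sup>2 + of_int (p\<^sup>2) * z\<^sup>2 - of_int (2 * p) * x * z - of_int q * y * z,
     of_int q * z\<^sup>2 - x * y, y\<^sup>2 + of_int p * z\<^sup>2 - x * z))"

definition norm_form :: "'a::comm_ring_1 \<Rightarrow> 'a \<Rightarrow> 'a \<Rightarrow> 'a" where
  "norm_form x y z = x ^ 3 + of_int q * y ^ 3 + of_int (q\<^sup>2) * z ^ 3 + of_int p * x * y\<^sup>2
     + of_int (p\<^sup>2) * x * z\<^sup>2 - of_int (2 * p) * x\<^sup>2 * z + of_int (p * q) * y * z\<^sup>2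
     - of_int (3 * q) * x * y * z"

lemma quad_adjugate: "quad (adjugate (x, y, z)) \<theta> = conj_form (of_rat x) (of_rat y) (of_rat z)"
proof -
  have t4: "\<theta> ^ 4 = q * \<theta> - p * \<theta>\<^sup>2"
  proof -
    have "\<theta> ^ 4 = \<theta> * \<theta> ^ 3" by (simp add: power3_eq_cube power4_eq_xxxx)
    then show ?thesis unfolding root by (simp add: power2_eq_square algebra_simps)
  qed
  have "conj_form X Y Z = X\<^sup>2 + p * Y\<^sup>2 + p\<^sup>2 * Z\<^sup>2 - 2 * p * X * Z - X * Y * \<theta>
      - p * Y * Z * \<theta> + (Y\<^sup>2 + 2 * p * Z\<^sup>2 - X * Z) * \<theta>\<^sup>2 - Y * Z * \<theta> ^ 3 + Z\<^sup>2 * \<theta> ^ 4" for X Y Z :: real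
  proof -
    define h where "h = \<theta> / 2"
    have \<theta>: "\<theta> = 2 * h" by (simp add: h_def)
    have c: "conj_form X Y Z = (X - Y * h - Z * (p + 2 * h\<^sup>2))\<^sup>2 + (p + 3 * h\<^sup>2) * (Y - Z * \<theta>)\<^sup>2"
      by (simp add: conj_form_def h_def power_divide)
    show ?thesis unfolding c unfolding \<theta> by (simp add: power2_eq_square power3_eq_cube power4_eq_xxxx algebra_simps)
  qed
  then show ?thesis unfolding t4 root
    by (simp add: adjugate_def quad_def of_rat_add of_rat_diff of_rat_mult of_rat_power)
      (simp add: power2_eq_square algebra_simps)
qed

lemma quad_mult_adjugate:
  "quad (x, y, z) \<theta> * quad (adjugate (x, y, z)) \<theta> = of_rat (norm_form x y z)"
proof -
  have "quad (x, y, z) \<theta> * quad (adjugate (x, y, z)) \<theta> = quad (norm_form x y z, 0, 0) \<theta>"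
    unfolding adjugate_def prod.case quad_mult[of \<theta>, OF root]
    by (simp add: norm_form_def power2_eq_square power3_eq_cube algebra_simps)
  then show ?thesis by (simp add: quad_of_rat)
qed

lemma p_theta_pos: "real_of_int p + 3 * \<theta>\<^sup>2 / 4 > 0"
  using p_pos by (simp add: add_pos_nonneg)

text \<open>If both squares vanish, then \<open>y = z\<theta>\<close>, and irrationality of \<open>\<theta>\<close> forces all coordinates to be 0.\<close>

lemma conj_form_pos:
  assumes "quad (x, y, z) \<theta> \<noteq> 0"
  shows "conj_form (of_rat x) (of_rat y) (of_rat z) > 0"
proof (rule ccontr)
  assume "\<not> ?thesis"
  then have le: "conj_form (of_rat x) (of_rat y) (of_rat z) \<le> 0" by simp
  define a where "a = of_rat x - of_rat y * \<theta> / 2 - of_rat z * (p + \<theta>\<^sup>2 / 2)"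
  define b where "b = of_rat y - of_rat z * \<theta>"
  have "a\<^sup>2 + (p + 3 * \<theta>\<^sup>2 / 4) * b\<^sup>2 \<le> 0" using le by (simp add: conj_form_def a_def b_def)
  moreover have "0 \<le> (p + 3 * \<theta>\<^sup>2 / 4) * b\<^sup>2" using p_theta_pos by simp
  ultimately have "a\<^sup>2 = 0" "(p + 3 * \<theta>\<^sup>2 / 4) * b\<^sup>2 = 0" using zero_le_power2[of a] by linarith+
  then have "a = 0" "b = 0" using p_theta_pos by auto
  then have "quad (y, - z, 0) \<theta> = 0" by (simp add: quad_def b_def of_rat_minus)
  then have "y = 0" "z = 0" using quad_root_eq_0[of y "- z" 0] by auto
  then show False using \<open>a = 0\<close> assms by (simp add: a_def quad_def)
qed

abbreviation K :: "real set" where "K \<equiv> rat_adjoin \<theta>"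

text \<open>The inverse of a non-zero element is its adjugate divided by its norm.\<close>

lemma range_quad_is_field: "is_real_subfield (range (\<lambda>t. quad t \<theta>))"
proof -
  have mul: "quad s \<theta> * quad t \<theta> \<in> range (\<lambda>t. quad t \<theta>)" for s t
    by (cases s; cases t) (use quad_mult[of \<theta>, OF root] in auto)
  have add: "quad s \<theta> + quad t \<theta> \<in> range (\<lambda>t. quad t \<theta>)" for s t
    by (cases s; cases t) (auto simp: quad_add)
  show ?thesis
    unfolding is_real_subfield_def
  proof (intro conjI ballI)
    show "0 \<in> range (\<lambda>t. quad t \<theta>)" "1 \<in> range (\<lambda>t. quad t \<theta>)"
      using quad_of_rat[of 0 \<theta>] quad_of_rat[of 1 \<theta>] by (metis of_rat_0 of_rat_1 rangeI)+
  next
    fix u v assume "u \<in> range (\<lambda>t. quad t \<theta>)" "v \<in> range (\<lambda>t. quad t \<theta>)"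
    then obtain s t where st: "u = quad s \<theta>" "v = quad t \<theta>" by blast
    show "u + v \<in> range (\<lambda>t. quad t \<theta>)" "u * v \<in> range (\<lambda>t. quad t \<theta>)"
      unfolding st by (fact add mul)+
  next
    fix u assume "u \<in> range (\<lambda>t. quad t \<theta>)"
    then obtain x y z where u: "u = quad (x, y, z) \<theta>" by (metis imageE prod_cases3)
    have "- u = quad (- x, - y, - z) \<theta>" by (simp add: u quad_def of_rat_minus)
    then show "- u \<in> range (\<lambda>t. quad t \<theta>)" by blast
    show "inverse u \<in> range (\<lambda>t. quad t \<theta>)"
    proof (cases "u = 0")
      case True
      then show ?thesis using u by auto
    next
      case False
      then have "quad (adjugate (x, y, z)) \<theta> \<noteq> 0"
        using conj_form_pos[of x y z] u by (simp add: quad_adjugate)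
      then have N: "of_rat (norm_form x y z) \<noteq> (0::real)"
        using quad_mult_adjugate[of x y z] False u by auto
      have "inverse u = quad (adjugate (x, y, z)) \<theta> * quad (inverse (norm_form x y z), 0, 0) \<theta>"
      proof (rule inverse_unique)
        have "u * (quad (adjugate (x, y, z)) \<theta> * quad (inverse (norm_form x y z), 0, 0) \<theta>)
            = of_rat (norm_form x y z) * quad (inverse (norm_form x y z), 0, 0) \<theta>"
          unfolding u quad_mult_adjugate[symmetric] by (simp only: mult.assoc)
        also have "\<dots> = 1" using N by (simp add: quad_of_rat of_rat_inverse)
        finally show "u * (quad (adjugate (x, y, z)) \<theta> 
          * quad (inverse (norm_form x y z), 0, 0) \<theta>) = 1" .
      qed
      then show ?thesis using mul by simp
    qed
  qed
qed

lemma K_eq: "K = range (\<lambda>t. quad t \<theta>)"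
proof
  have "\<theta> \<in> range (\<lambda>t. quad t \<theta>)"
    by (rule range_eqI[of _ _ "(0, 1, 0)"]) (simp add: quad_def)
  then show "K \<subseteq> range (\<lambda>t. quad t \<theta>)"
    using range_quad_is_field unfolding rat_adjoin_def by blast
  show "range (\<lambda>t. quad t \<theta>) \<subseteq> K"
    unfolding rat_adjoin_def
  proof (intro subsetI InterI)
    fix u F assume "u \<in> range (\<lambda>t. quad t \<theta>)" and F: "F \<in> {F. is_real_subfield F \<and> \<theta> \<in> F}"
    then obtain x y z where "u = quad (x, y, z) \<theta>" by auto
    moreover have "of_rat x \<in> F" "of_rat y \<in> F" "of_rat z \<in> F"
      using F is_real_subfield_of_rat by blast+
    ultimately show "u \<in> F"
      using F by (simp add: quad_def power2_eq_square is_real_subfield_def)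
  qed
qed

lemma quad_in_K: "quad t \<theta> \<in> K" by (simp add: K_eq)

lemma K_cases:
  assumes "\<alpha> \<in> K" obtains x y z where "\<alpha> = quad (x, y, z) \<theta>"
  using assms unfolding K_eq by (metis imageE prod_cases3)

lemma K_is_field: "is_real_subfield K"
  using range_quad_is_field unfolding K_eq .

lemma K_closed: "0 \<in> K" "1 \<in> K" "\<alpha> \<in> K \<Longrightarrow> \<beta> \<in> K \<Longrightarrow> \<alpha> + \<beta> \<in> K"
  "\<alpha> \<in> K \<Longrightarrow> \<beta> \<in> K \<Longrightarrow> \<alpha> * \<beta> \<in> K" "\<alpha> \<in> K \<Longrightarrow> - \<alpha> \<in> K" "\<alpha> \<in> K \<Longrightarrow> inverse \<alpha> \<in> K"
  using K_is_field unfolding is_real_subfield_def by blast+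

lemma theta_in_K: "\<theta> \<in> K" unfolding rat_adjoin_def by blast

text \<open>The root of the cubic in the upper half plane.\<close>

definition \<zeta> :: complex where
  "\<zeta> = Complex (- \<theta> / 2) (sqrt (p + 3 * \<theta>\<^sup>2 / 4))"

lemma cubic_factor:
  "w ^ 3 + of_int p * w - of_int q = (w - of_real \<theta>) * ((w - \<zeta>) * (w - cnj \<zeta>))"
proof -
  have s: "\<zeta> + cnj \<zeta> = - of_real \<theta>" by (simp add: \<zeta>_def complex_eq_iff)
  have m: "\<zeta> * cnj \<zeta> = of_int p + (of_real \<theta>)\<^sup>2"
  proof -
    have "(sqrt (p + 3 * \<theta>\<^sup>2 / 4))\<^sup>2 = p + 3 * \<theta>\<^sup>2 / 4" using p_theta_pos by simp
    then have "(Re \<zeta>)\<^sup>2 + (Im \<zeta>)\<^sup>2 = p + \<theta>\<^sup>2" by (simp add: \<zeta>_def power_divide)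
    then show ?thesis unfolding complex_mult_cnj by simp
  qed
  have q: "of_int q = of_real \<theta> ^ 3 + of_int p * complex_of_real \<theta>"
    using arg_cong[OF root, of complex_of_real] by (simp add: algebra_simps)
  have "(w - \<zeta>) * (w - cnj \<zeta>) = w\<^sup>2 - (\<zeta> + cnj \<zeta>) * w + \<zeta> * cnj \<zeta>"
    by (simp add: power2_eq_square algebra_simps)
  then show ?thesis unfolding s m q by (simp add: power2_eq_square power3_eq_cube algebra_simps)
qed

definition coords :: "real \<Rightarrow> rat \<times> rat \<times> rat" where "coords = inv (\<lambda>t. quad t \<theta>)"

lemma coords_quad [simp]: "coords (quad t \<theta>) = t"
  unfolding coords_def by (rule inv_f_f) (simp add: inj_def quad_inject)

definition emb :: "complex \<Rightarrow> real \<Rightarrow> complex" where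
  "emb w = (\<lambda>\<alpha>\<in>K. quad (coords \<alpha>) w)"

lemma emb_quad [simp]: "emb w (quad t \<theta>) = quad t w"
  by (simp add: emb_def quad_in_K)

lemma emb_theta: "emb w \<theta> = w"
proof -
  have "emb w (quad (0, 1, 0) \<theta>) = quad (0, 1, 0) w" by (rule emb_quad)
  then show ?thesis by (simp add: quad_def)
qed

lemma emb_in_embeddings:
  assumes "w ^ 3 = of_int q - of_int p * w"
  shows "emb w \<in> embeddings K"
  unfolding embeddings_def
proof (intro CollectI conjI ballI)
  show "emb w \<in> extensional K" by (simp add: emb_def)
  have "emb w (quad (1, 0, 0) \<theta>) = quad (1, 0, 0) w" by (rule emb_quad)
  then show "emb w 1 = 1" by (simp add: quad_def)
  fix \<alpha> \<beta> assume "\<alpha> \<in> K" "\<beta> \<in> K"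
  then obtain x y z x' y' z' where ab: "\<alpha> = quad (x, y, z) \<theta>" "\<beta> = quad (x', y', z') \<theta>"
    by (elim K_cases) blast
  show "emb w (\<alpha> + \<beta>) = emb w \<alpha> + emb w \<beta>" unfolding ab by (simp only: quad_add emb_quad)
  show "emb w (\<alpha> * \<beta>) = emb w \<alpha> * emb w \<beta>"
    unfolding ab by (simp only: quad_mult[of \<theta>, OF root] emb_quad quad_mult[OF assms])
qed

lemma embedding_of_rat:
  assumes "\<sigma> \<in> embeddings K"
  shows "\<sigma> (of_rat a) = of_rat a"
proof -
  have \<sigma>: "\<sigma> 1 = 1" "\<And>x y. x \<in> K \<Longrightarrow> y \<in> K \<Longrightarrow> \<sigma> (x + y) = \<sigma> x + \<sigma> y"
    "\<And>x y. x \<in> K \<Longrightarrow> y \<in> K \<Longrightarrow> \<sigma> (x * y) = \<sigma> x * \<sigma> y"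
    using assms unfolding embeddings_def by blast+
  have 0: "\<sigma> 0 = 0" using \<sigma>(2)[OF K_closed(1,1)] by simp
  have K: "of_rat c \<in> K" for c by (rule is_real_subfield_of_rat[OF K_is_field])
  have natK: "of_nat n \<in> K" for n using K[of "of_nat n"] by simp
  have nat: "\<sigma> (of_nat n) = of_nat n" for n
    by (induction n) (simp_all add: 0 \<sigma> K_closed natK)
  have int: "\<sigma> (of_int k) = of_int k" for k
  proof -
    have "\<sigma> (of_int k) + of_nat (nat (- k)) = \<sigma> (of_int k + of_nat (nat (- k)))"
      using \<sigma>(2) K[of "of_int k"] natK nat by simp
    also have "of_int k + of_nat (nat (- k)) = (of_nat (nat k) :: real)" by simp
    finally show ?thesis unfolding nat by (cases "k \<ge> 0") (auto simp: eq_neg_iff_add_eq_0)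
  qed
  show ?thesis
  proof (cases a)
    case (Fract m n)
    \<comment> \<open>clear the denominator, since only integers are known to be fixed so far\<close>
    have "of_int n * \<sigma> (of_rat a) = \<sigma> (of_int n * of_rat a)"
      using \<sigma>(3)[of "of_int n" "of_rat a"] K[of "of_int n"] K int by simp
    also have "of_int n * of_rat a = (of_int m :: real)" using Fract by (simp add: of_rat_rat)
    finally show ?thesis using Fract by (simp add: of_rat_rat int field_simps)
  qed
qed

text \<open>An embedding fixes the rationals and sends \<open>\<theta>\<close> to a root of the cubic, which determines it; conversely
  each of the three roots defines an embedding because coordinates are unique.\<close>

lemma embeddings_K: "embeddings K = emb ` {of_real \<theta>, \<zeta>, cnj \<zeta>}"
proof (intro equalityI subsetI)
  fix \<sigma> assume s: "\<sigma> \<in> embeddings K"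
  then have ext: "\<sigma> \<in> extensional K" and \<sigma>: "\<sigma> 1 = 1" 
    "\<And>x y. x \<in> K \<Longrightarrow> y \<in> K \<Longrightarrow> \<sigma> (x + y) = \<sigma> x + \<sigma> y"
    "\<And>x y. x \<in> K \<Longrightarrow> y \<in> K \<Longrightarrow> \<sigma> (x * y) = \<sigma> x * \<sigma> y"
    unfolding embeddings_def by blast+
  have K: "of_rat c \<in> K" for c by (rule is_real_subfield_of_rat[OF K_is_field])
  define w where "w = \<sigma> \<theta>"
  have sq: "\<sigma> (quad t \<theta>) = quad t w" for t
  proof -
    obtain x y z where t: "t = (x, y, z)" by (metis prod_cases3)
    show ?thesis unfolding t quad_def prod.case power2_eq_square
      by (simp add: \<sigma> K K_closed theta_in_K embedding_of_rat[OF s] w_def)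
  qed
  have "\<sigma> = emb w"
    by (rule extensionalityI[OF ext]) (auto simp: emb_def K_eq sq)
  moreover have "w ^ 3 = of_int q - of_int p * w"
  proof -
    have "w ^ 3 = \<sigma> (\<theta> ^ 3)"
      unfolding power3_eq_cube by (simp add: \<sigma> K_closed theta_in_K w_def)
    also have "\<theta> ^ 3 = quad (of_int q, - of_int p, 0) \<theta>"
      unfolding root by (simp add: quad_def of_rat_minus)
    finally show ?thesis unfolding sq by (simp add: quad_def of_rat_minus)
  qed
  then have "w \<in> {of_real \<theta>, \<zeta>, cnj \<zeta>}" using cubic_factor[of w] by auto
  ultimately show "\<sigma> \<in> emb ` {of_real \<theta>, \<zeta>, cnj \<zeta>}" by blast
next
  fix \<sigma> assume "\<sigma> \<in> emb ` {of_real \<theta>, \<zeta>, cnj \<zeta>}"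
  then obtain w where w: "\<sigma> = emb w" "w \<in> {of_real \<theta>, \<zeta>, cnj \<zeta>}" by blast
  have "w ^ 3 + of_int p * w - of_int q = 0" unfolding cubic_factor using w(2) by auto
  then show "\<sigma> \<in> embeddings K"
    unfolding w(1) by (intro emb_in_embeddings) (simp add: algebra_simps)
qed

lemma emb_real: "emb (of_real \<theta>) = restrict complex_of_real K"
  by (rule extensionalityI[of _ K]) (auto simp: emb_def K_eq quad_of_real)

lemma emb_distinct: "emb \<zeta> \<noteq> emb (cnj \<zeta>)" "emb \<zeta> \<noteq> emb (of_real \<theta>)" "emb (cnj \<zeta>) \<noteq> emb (of_real \<theta>)"
proof -
  have "Im \<zeta> > 0" using p_theta_pos by (simp add: \<zeta>_def)
  then have "\<zeta> \<noteq> cnj \<zeta>" "\<zeta> \<noteq> of_real \<theta>" "cnj \<zeta> \<noteq> of_real \<theta>" by (auto simp: complex_eq_iff)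
  then show "emb \<zeta> \<noteq> emb (cnj \<zeta>)" "emb \<zeta> \<noteq> emb (of_real \<theta>)" "emb (cnj \<zeta>) \<noteq> emb (of_real \<theta>)"
    by (metis emb_theta)+
qed

lemma emb_cnj: "\<alpha> \<in> K \<Longrightarrow> emb (cnj \<zeta>) \<alpha> = cnj (emb \<zeta> \<alpha>)"
  by (auto simp: K_eq quad_cnj)

text \<open>The two embeddings other than the inclusion are complex conjugate, so the product of the
  conjugates is a squared modulus. This gives multiplicativity and positivity at once.\<close>

lemma conj_prod_eq_cmod: 
  assumes "\<alpha> \<in> K" shows "conj_prod K \<alpha> = (cmod (emb \<zeta> \<alpha>))\<^sup>2"
proof -
  have "embeddings K - {restrict complex_of_real K} = {emb \<zeta>, emb (cnj \<zeta>)}"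
    unfolding embeddings_K emb_real[symmetric] using emb_distinct by auto
  then show ?thesis unfolding conj_prod_def using emb_distinct
    by (simp add: emb_cnj assms complex_mult_cnj cmod_power2)
qed

lemma field_norm_eq: 
  assumes "\<alpha> \<in> K" shows "field_norm K \<alpha> = \<alpha> * conj_prod K \<alpha>"
proof -
  have "embeddings K = {restrict complex_of_real K, emb \<zeta>, emb (cnj \<zeta>)}"
    unfolding embeddings_K emb_real[symmetric] by auto
  then show ?thesis unfolding field_norm_def conj_prod_eq_cmod[OF assms] using emb_distinct assms
    by (simp add: emb_cnj complex_mult_cnj cmod_power2 emb_real)
qed

lemma conj_prod_mult: "\<alpha> \<in> K \<Longrightarrow> \<beta> \<in> K \<Longrightarrow> conj_prod K (\<alpha> * \<beta>) = conj_prod K \<alpha> * conj_prod K \<beta>"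
proof -
  assume "\<alpha> \<in> K" "\<beta> \<in> K"
  moreover have "emb \<zeta> \<in> embeddings K" by (simp add: embeddings_K)
  ultimately have "emb \<zeta> (\<alpha> * \<beta>) = emb \<zeta> \<alpha> * emb \<zeta> \<beta>" unfolding embeddings_def by blast
  then show ?thesis using \<open>\<alpha> \<in> K\<close> \<open>\<beta> \<in> K\<close>
    by (simp add: conj_prod_eq_cmod K_closed norm_mult power_mult_distrib)
qed

lemma conj_prod_quad:
  "conj_prod K (quad (x, y, z) \<theta>) = conj_form (of_rat x) (of_rat y) (of_rat z)"
proof -
  define s where "s = sqrt (p + 3 * \<theta>\<^sup>2 / 4)"
  have s2: "s\<^sup>2 = p + 3 * \<theta>\<^sup>2 / 4" using p_theta_pos by (simp add: s_def)
  have r: "of_rat a = complex_of_real (of_rat a)" for a by (cases a) (simp add: of_rat_rat)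
  have \<zeta>s: "\<zeta> = Complex (- \<theta> / 2) s" by (simp add: \<zeta>_def s_def)
  have z2: "(Complex (- \<theta> / 2) s)\<^sup>2 = Complex (\<theta>\<^sup>2 / 4 - s\<^sup>2) (- \<theta> * s)"
    by (simp add: power2_eq_square complex_eq_iff)
  have Re: "Re (emb \<zeta> (quad (x, y, z) \<theta>)) 
      = of_rat x - of_rat y * \<theta> / 2 + of_rat z * (\<theta>\<^sup>2 / 4 - s\<^sup>2)"
    and Im: "Im (emb \<zeta> (quad (x, y, z) \<theta>)) = s * (of_rat y - of_rat z * \<theta>)"
    unfolding emb_quad unfolding quad_def prod.case r by (simp_all add: z2[simplified] \<zeta>s algebra_simps)
  show ?thesis unfolding conj_prod_eq_cmod[OF quad_in_K] cmod_power2 Re Im power_mult_distrib s2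
    by (simp add: conj_form_def algebra_simps)
qed

lemma norm_quad: "quad (x, y, z) \<theta> * conj_prod K (quad (x, y, z) \<theta>) = of_rat (norm_form x y z)"
  unfolding conj_prod_quad quad_adjugate[symmetric] quad_mult_adjugate ..

lemma conj_prod_pos: "\<alpha> \<in> K \<Longrightarrow> \<alpha> \<noteq> 0 \<Longrightarrow> conj_prod K \<alpha> > 0"
  by (erule K_cases) (simp add: conj_form_pos conj_prod_quad)

lemma conj_prod_1: "conj_prod K 1 = 1"
  using conj_prod_quad[of 1 0 0] by (simp add: quad_def conj_form_def)

end
section \<open>Units and lattice minima of a monogenic field\<close>

locale monogenic_depressed_cubic = depressed_cubic +
  assumes power_basis: "int_adjoin \<theta> = ring_of_integers (rat_adjoin \<theta>)"
begin

abbreviation Q where "Q \<equiv> conj_prod K"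
abbreviation \<O> where "\<O> \<equiv> ring_of_integers K"

lemma O_sub_K: "\<alpha> \<in> \<O> \<Longrightarrow> \<alpha> \<in> K"
  by (simp add: ring_of_integers_def)

abbreviation int_quad :: "int \<Rightarrow> int \<Rightarrow> int \<Rightarrow> real" where "int_quad x y z \<equiv> quad (of_int x, of_int y, of_int z) \<theta>"

lemma int_quad: "int_quad x y z = x + y * \<theta> + z * \<theta>\<^sup>2" by (simp add: quad_def)

text \<open>By the power basis hypothesis the integers are the values at \<open>\<theta>\<close> of integer polynomials, and Horner's
  scheme reduces these modulo the monic cubic to integer coordinates.\<close>

lemma O_eq: "\<alpha> \<in> \<O> \<longleftrightarrow> (\<exists>x y z. \<alpha> = int_quad x y z)"
proof
  assume "\<alpha> \<in> \<O>"
  then obtain f :: "int poly" where "\<alpha> = poly (map_poly of_int f) \<theta>"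
    unfolding power_basis[symmetric] int_adjoin_def by blast
  then show "\<exists>x y z. \<alpha> = int_quad x y z"
  proof (induction f arbitrary: \<alpha>)
    case 0
    then have "\<alpha> = int_quad 0 0 0" by (simp add: quad_def)
    then show ?case by blast
  next
    case (pCons a f)
    obtain x y z where f: "poly (map_poly of_int f) \<theta> = int_quad x y z" using pCons.IH by blast
    have "\<alpha> = a + \<theta> * int_quad x y z"
      using pCons.hyps pCons.prems f by (simp add: map_poly_pCons)
    also have "\<dots> = a + x * \<theta> + y * \<theta>\<^sup>2 + z * \<theta> ^ 3"
      by (simp add: int_quad power2_eq_square power3_eq_cube algebra_simps)
    also have "\<dots> = int_quad (a + z * q) (x - p * z) y"
      unfolding root int_quad by (simp add: algebra_simps)
    finally show ?case by blast
  qed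
next
  assume "\<exists>x y z. \<alpha> = int_quad x y z"
  then obtain x y z where "\<alpha> = int_quad x y z" by blast
  then have "\<alpha> = poly (map_poly of_int [:x, y, z:]) \<theta>"
    by (simp add: int_quad map_poly_pCons power2_eq_square algebra_simps)
  then show "\<alpha> \<in> \<O>" unfolding power_basis[symmetric] int_adjoin_def by blast
qed

lemma O_closed: "0 \<in> \<O>" "1 \<in> \<O>" "\<alpha> \<in> \<O> \<Longrightarrow> \<beta> \<in> \<O> \<Longrightarrow> \<alpha> * \<beta> \<in> \<O>" "\<alpha> \<in> \<O> \<Longrightarrow> - \<alpha> \<in> \<O>"
proof -
  show "0 \<in> \<O>" "1 \<in> \<O>" "\<alpha> \<in> \<O> \<Longrightarrow> - \<alpha> \<in> \<O>"
    unfolding ring_of_integers_def using K_closed by auto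
  assume "\<alpha> \<in> \<O>" "\<beta> \<in> \<O>"
  then obtain x y z x' y' z' where ab: "\<alpha> = int_quad x y z" "\<beta> = int_quad x' y' z'" unfolding O_eq by blast
  have "\<alpha> * \<beta> = int_quad (x * x' + q * (y * z' + z * y'))
      (x * y' + y * x' - p * (y * z' + z * y') + q * (z * z')) (x * z' + y * y' + z * x' - p * (z * z'))"
    unfolding ab quad_mult[of \<theta>, OF root] by simp
  then show "\<alpha> * \<beta> \<in> \<O>" unfolding O_eq by blast
qed

lemma norm_in_Ints: "\<alpha> \<in> \<O> \<Longrightarrow> \<alpha> * Q \<alpha> \<in> \<int>"
proof -
  assume "\<alpha> \<in> \<O>"
  then obtain x y z where a: "\<alpha> = int_quad x y z" using O_eq by blast
  have "norm_form (of_int x) (of_int y) (of_int z) = (of_int (norm_form x y z) :: rat)"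
    by (simp add: norm_form_def)
  then show ?thesis unfolding a norm_quad by simp
qed

abbreviation U where "U \<equiv> unit_group K"

lemma unit_mult: "u \<in> U \<Longrightarrow> v \<in> U \<Longrightarrow> u * v \<in> U"
proof -
  assume "u \<in> U" "v \<in> U"
  then obtain u' v' where "u \<in> \<O>" "v \<in> \<O>" "u' \<in> \<O>" "v' \<in> \<O>" "u * u' = 1" "v * v' = 1"
    unfolding unit_group_def by blast
  moreover from this have "(u * v) * (u' * v') = 1" by (metis mult.left_commute mult.right_neutral mult.assoc)
  ultimately show ?thesis unfolding unit_group_def using O_closed by blast
qed

lemma unit_inverse: "u \<in> U \<Longrightarrow> inverse u \<in> U"
proof -
  assume "u \<in> U"
  then obtain v where v: "u \<in> \<O>" "v \<in> \<O>" "u * v = 1" unfolding unit_group_def by blast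
  then have "inverse u = v" by (simp add: inverse_unique)
  then show ?thesis unfolding unit_group_def using v by (auto simp: mult.commute)
qed

lemma unit_1: "1 \<in> U" unfolding unit_group_def using O_closed by auto

lemma unit_minus: "u \<in> U \<Longrightarrow> - u \<in> U"
proof -
  assume "u \<in> U"
  then obtain v where "u \<in> \<O>" "v \<in> \<O>" "u * v = 1" unfolding unit_group_def by blast
  then have "- u \<in> \<O>" "- v \<in> \<O>" "(- u) * (- v) = 1" using O_closed by auto
  then show ?thesis unfolding unit_group_def by blast
qed

lemma unit_powi: "u \<in> U \<Longrightarrow> u powi k \<in> U"
proof -
  assume u: "u \<in> U"
  have "v ^ n \<in> U" if "v \<in> U" for v n by (induction n) (auto intro: unit_1 unit_mult that)
  then show ?thesis using u unit_inverse by (simp add: power_int_def)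
qed

lemma unit_in_O: "u \<in> U \<Longrightarrow> u \<in> \<O>" by (simp add: unit_group_def)

lemma unit_nonzero: "u \<in> U \<Longrightarrow> u \<noteq> 0" unfolding unit_group_def by auto

text \<open>The norms of \<open>u\<close> and of its inverse are integers with product 1, and both are positive.\<close>

lemma unit_norm_1:
  assumes u: "u \<in> U" "u > 0"
  shows "u * Q u = 1"
proof -
  obtain v where v: "u \<in> \<O>" "v \<in> \<O>" "u * v = 1" using u unfolding unit_group_def by blast
  then have vpos: "v > 0" using u by (metis zero_less_mult_pos zero_less_one)
  have "(u * Q u) * (v * Q v) = 1"
    using conj_prod_mult[of u v] v O_sub_K conj_prod_1 by (simp add: mult_ac)
  moreover obtain m n where mn: "u * Q u = of_int m" "v * Q v = of_int n" using norm_in_Ints v by (metis Ints_cases)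
  ultimately have "m * n = 1" by (metis of_int_1 of_int_eq_iff of_int_mult)
  moreover have "m > 0" "n > 0"
    using mn conj_prod_pos[of u] conj_prod_pos[of v] v u vpos O_sub_K 
    by (metis mult_pos_pos of_int_0_less_iff less_imp_neq)+
  ultimately have "m = 1" using pos_zmult_eq_1_iff by blast
  then show ?thesis using mn by simp
qed

lemma norm_ge_1: "\<alpha> \<in> \<O> \<Longrightarrow> \<alpha> \<noteq> 0 \<Longrightarrow> \<bar>\<alpha>\<bar> * Q \<alpha> \<ge> 1"
proof -
  assume a: "\<alpha> \<in> \<O>" "\<alpha> \<noteq> 0"
  then have "Q \<alpha> > 0" using conj_prod_pos O_sub_K by blast
  moreover obtain n where "\<alpha> * Q \<alpha> = of_int n" using norm_in_Ints a by (metis Ints_cases)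
  ultimately have "\<bar>\<alpha>\<bar> * Q \<alpha> = \<bar>of_int n\<bar>" by (metis abs_mult abs_of_pos)
  moreover have "n \<noteq> 0" using \<open>Q \<alpha> > 0\<close> \<open>\<alpha> * Q \<alpha> = of_int n\<close> a by auto
  ultimately show ?thesis by linarith
qed

abbreviation Mins where "Mins \<equiv> lattice_minima K"

lemma Mins_D: "\<alpha> \<in> Mins \<Longrightarrow> \<alpha> \<in> \<O> \<and> \<alpha> > 0"
  by (simp add: lattice_minima_def)

text \<open>A non-zero integer has norm of absolute value at least 1, so it cannot be smaller than 1 in both
  absolute values.\<close>

lemma one_in_Mins: "1 \<in> Mins"
proof -
  have "\<not> (\<bar>\<nu>\<bar> < 1 \<and> Q \<nu> < 1)" if "\<nu> \<in> \<O>" "\<nu> \<noteq> 0" for \<nu>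
  proof
    assume "\<bar>\<nu>\<bar> < 1 \<and> Q \<nu> < 1"
    then have "\<bar>\<nu>\<bar> * Q \<nu> < 1 * 1"
      using conj_prod_pos[of \<nu>] O_sub_K that by (intro mult_strict_mono) auto
    then show False using norm_ge_1 that by fastforce
  qed
  then show ?thesis unfolding lattice_minima_def using O_closed conj_prod_1 by auto
qed

lemma unit_mult_Mins:
  assumes u: "u \<in> U" "u > 0" and a: "\<alpha> \<in> Mins"
  shows "u * \<alpha> \<in> Mins"
proof -
  have \<alpha>: "\<alpha> \<in> \<O>" "\<alpha> > 0" and m: "\<And>\<nu>. \<nu> \<in> \<O> \<Longrightarrow> \<nu> \<noteq> 0 \<Longrightarrow> \<bar>\<nu>\<bar> < \<alpha> \<Longrightarrow> \<not> Q \<nu> < Q \<alpha>"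
    using a by (auto simp: lattice_minima_def)
  have iO: "inverse u \<in> U" "inverse u > 0" using u unit_inverse by auto
  have False if n: "\<nu> \<in> \<O>" "\<nu> \<noteq> 0" "\<bar>\<nu>\<bar> < u * \<alpha>" "Q \<nu> < Q (u * \<alpha>)" for \<nu>
  proof (rule m[THEN notE])
    show "inverse u * \<nu> \<in> \<O>" using O_closed iO unit_in_O n by blast
    show "inverse u * \<nu> \<noteq> 0" using u n by simp
    show "\<bar>inverse u * \<nu>\<bar> < \<alpha>" using n(3) u by (simp add: abs_mult field_simps)
    have "Q \<nu> < Q u * Q \<alpha>"
      using n(4) conj_prod_mult O_sub_K unit_in_O u \<alpha> by simp
    then have "Q (inverse u) * Q \<nu> < Q (inverse u) * (Q u * Q \<alpha>)"
      using conj_prod_pos iO unit_in_O O_sub_K by (intro mult_strict_left_mono) auto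
    also have "\<dots> = Q \<alpha>" using conj_prod_mult[of "inverse u" u] iO u unit_in_O O_sub_K
      by (simp add: conj_prod_1 flip: mult.assoc)
    finally show "Q (inverse u * \<nu>) < Q \<alpha>"
      using conj_prod_mult iO unit_in_O O_sub_K n by simp
  qed
  then show ?thesis unfolding lattice_minima_def
    using O_closed unit_in_O u \<alpha> by auto
qed

lemma unit_mult_Mins_iff: "u \<in> U \<Longrightarrow> u > 0 \<Longrightarrow> u * \<alpha> \<in> Mins \<longleftrightarrow> \<alpha> \<in> Mins"
  using unit_mult_Mins[of "inverse u" "u * \<alpha>"] unit_mult_Mins unit_inverse unit_nonzero
  by (auto simp flip: mult.assoc)

lemma unit_in_Mins: "u \<in> U \<Longrightarrow> u > 0 \<Longrightarrow> u \<in> Mins"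
  using unit_mult_Mins_iff[of u 1] one_in_Mins by simp

text \<open>If \<open>\<gamma>\<close> were a minimum strictly between, then either \<open>|\<gamma>'| \<le> |\<beta>'|\<close>, excluded by the hypothesis, or \<open>\<beta>\<close>
  is smaller than \<open>\<gamma>\<close> in both absolute values. The closed inequality in the hypothesis is what
  rules out ties.\<close>

lemma gap_criterion:
  assumes b: "\<beta> \<in> \<O>" "0 < \<beta>" "\<beta> < \<alpha>"
    and only: "\<And>\<nu>. \<nu> \<in> \<O> \<Longrightarrow> \<nu> \<noteq> 0 \<Longrightarrow> \<bar>\<nu>\<bar> < \<alpha> \<Longrightarrow> Q \<nu> \<le> Q \<beta> \<Longrightarrow> \<bar>\<nu>\<bar> = \<beta>"
  shows "\<beta> \<in> Mins" and "Mins \<inter> {\<beta><..<\<alpha>} = {}"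
proof -
  show "\<beta> \<in> Mins" unfolding lattice_minima_def using b only by fastforce
  show "Mins \<inter> {\<beta><..<\<alpha>} = {}"
  proof (rule ccontr)
    assume "\<not> ?thesis"
    then obtain \<gamma> where g: "\<gamma> \<in> Mins" "\<beta> < \<gamma>" "\<gamma> < \<alpha>" by auto
    then have "\<not> Q \<beta> < Q \<gamma>" using b unfolding lattice_minima_def by fastforce
    then show False using only[of \<gamma>] g Mins_D[OF g(1)] by auto
  qed
qed

lemma next_minimum_eq:
  assumes "\<beta> \<in> Mins" "\<beta> < \<alpha>" "Mins \<inter> {\<beta><..<\<alpha>} = {}"
  shows "next_minimum K \<alpha> = \<beta>"
  unfolding next_minimum_def
proof (rule Greatest_equality)
  fix \<gamma> assume "\<gamma> \<in> Mins \<and> \<gamma> < \<alpha>"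
  then show "\<gamma> \<le> \<beta>" using assms(3) by (meson disjoint_iff greaterThanLessThan_iff not_le)
qed (use assms in simp)

lemma gap_scale:
  assumes u: "u \<in> U" "u > 0" and e: "Mins \<inter> {\<beta><..<\<alpha>} = {}"
  shows "Mins \<inter> {u * \<beta><..<u * \<alpha>} = {}"
proof (rule ccontr)
  assume "\<not> ?thesis"
  then obtain \<gamma> where g: "\<gamma> \<in> Mins" "u * \<beta> < \<gamma>" "\<gamma> < u * \<alpha>" by auto
  have "inverse u * \<gamma> \<in> Mins" using unit_mult_Mins[of "inverse u"] u unit_inverse g by simp
  moreover have "\<beta> < inverse u * \<gamma>" "inverse u * \<gamma> < \<alpha>" using g u by (simp_all add: field_simps)
  ultimately show False using e by auto
qed

lemma unit_orbit_mult:
  assumes u: "u \<in> U" "u > 0"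
  shows "unit_orbit K (u * \<alpha>) = unit_orbit K \<alpha>"
proof -
  have sub: "unit_orbit K (v * \<beta>) \<subseteq> unit_orbit K \<beta>" if "v \<in> U" "v > 0" for v \<beta>
    unfolding unit_orbit_def
  proof clarify
    fix w assume "w \<in> U" "w > 0"
    then have "w * v \<in> U" "w * v > 0" using that unit_mult by auto
    then show "\<exists>t. w * (v * \<beta>) = t * \<beta> \<and> t \<in> U \<and> t > 0" by (metis mult.assoc)
  qed
  show ?thesis
    using sub[of u \<alpha>] sub[of "inverse u" "u * \<alpha>"] u unit_inverse by (auto simp flip: mult.assoc)
qed

text \<open>Positive units have norm 1, so the norm is an invariant of the orbit; it is used to tell orbits
  apart.\<close>

lemma unit_orbit_norm:
  assumes "unit_orbit K \<alpha> = unit_orbit K \<beta>" "\<alpha> \<in> K" "\<beta> \<in> K"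
  shows "\<alpha> * Q \<alpha> = \<beta> * Q \<beta>"
proof -
  have "1 * \<alpha> \<in> unit_orbit K \<alpha>" unfolding unit_orbit_def using unit_1 zero_less_one by blast
  then have "\<alpha> \<in> unit_orbit K \<beta>" using assms by simp
  then obtain u where u: "u \<in> U" "u > 0" "\<alpha> = u * \<beta>" unfolding unit_orbit_def by blast
  then have "\<alpha> * Q \<alpha> = (u * Q u) * (\<beta> * Q \<beta>)"
    using conj_prod_mult[of u \<beta>] assms unit_in_O O_sub_K by simp
  then show ?thesis using unit_norm_1 u by simp
qed

lemma dpf_unit_mult:
  assumes u: "u \<in> U" "u > 0" and d: "diff_principal_factor K \<alpha>"
  shows "diff_principal_factor K (u * \<alpha>)"
proof -
  have a: "\<alpha> \<in> \<O>" "\<alpha> \<notin> U" "\<alpha> ^ 3 / field_norm K \<alpha> \<in> U"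
    "\<And>q. q \<in> \<rat> \<Longrightarrow> principal_ideal K \<alpha> \<noteq> principal_ideal K q"
    using d unfolding diff_principal_factor_def by blast+
  have iu: "inverse u \<in> U" using u unit_inverse by blast
  have "u * \<alpha> \<notin> U"
  proof
    assume "u * \<alpha> \<in> U"
    then have "inverse u * (u * \<alpha>) \<in> U" using iu unit_mult by blast
    then show False using a(2) u by (simp flip: mult.assoc)
  qed
  moreover have "field_norm K (u * \<alpha>) = field_norm K \<alpha>"
  proof -
    have "u \<in> K" "\<alpha> \<in> K" "u * \<alpha> \<in> K" using u a unit_in_O O_sub_K K_closed by auto
    then have "field_norm K (u * \<alpha>) = (u * Q u) * (\<alpha> * Q \<alpha>)"
      by (simp add: field_norm_eq conj_prod_mult)
    then show ?thesis using unit_norm_1 u \<open>\<alpha> \<in> K\<close> by (simp add: field_norm_eq)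
  qed
  then have "(u * \<alpha>) ^ 3 / field_norm K (u * \<alpha>) \<in> U"
    using unit_mult[OF _ a(3), of "u ^ 3"] unit_mult[OF u(1) unit_mult[OF u(1) u(1)]]
    by (simp add: power_mult_distrib power3_eq_cube[of u] mult.assoc)
  moreover have "principal_ideal K (u * \<alpha>) = principal_ideal K \<alpha>"
    unfolding principal_ideal_def
  proof (intro equalityI subsetI; clarify)
    fix x assume x: "x \<in> \<O>"
    show "\<exists>y. u * \<alpha> * x = \<alpha> * y \<and> y \<in> \<O>"
      by (rule exI[of _ "u * x"]) (use O_closed unit_in_O u x in \<open>auto simp: mult_ac\<close>)
    show "\<exists>y. \<alpha> * x = u * \<alpha> * y \<and> y \<in> \<O>"
      by (rule exI[of _ "inverse u * x"]) (use O_closed unit_in_O iu u x in \<open>auto simp: mult_ac\<close>)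
  qed
  moreover have "u * \<alpha> \<in> \<O>" using O_closed unit_in_O u a by blast
  ultimately show ?thesis unfolding diff_principal_factor_def using a(4) by auto
qed

text \<open>The last hypothesis says that \<open>\<alpha>\<close> is a primitive lattice vector. If \<open>\<alpha>\<O> = q\<O>\<close> with \<open>q\<close> rational, then
  \<open>\<alpha>/q\<close> is an integer, so \<open>1/q\<close> is a rational integer by primitivity; as \<open>q/\<alpha>\<close> is an integer too,
  multiplying it by \<open>1/q\<close> gives the inverse of \<open>\<alpha>\<close>, and \<open>\<alpha>\<close> would be a unit.\<close>

lemma dpf_of_primitive:
  assumes a: "\<alpha> \<in> \<O>" "\<alpha> \<noteq> 0" "\<alpha> \<notin> U" "\<alpha> ^ 3 / field_norm K \<alpha> \<in> U"
    and prim: "\<And>c. of_rat c * \<alpha> \<in> \<O> \<Longrightarrow> c \<in> \<int>"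
  shows "diff_principal_factor K \<alpha>"
proof -
  have False if q: "q \<in> \<rat>" and e: "principal_ideal K \<alpha> = principal_ideal K q" for q
  proof -
    obtain c where c: "q = of_rat c" using q by (auto elim: Rats_cases)
    have "\<alpha> * 1 \<in> principal_ideal K \<alpha>" unfolding principal_ideal_def using O_closed by blast
    then obtain x where x: "\<alpha> = q * x" "x \<in> \<O>" unfolding e by (auto simp: principal_ideal_def)
    have "q * 1 \<in> principal_ideal K q" unfolding principal_ideal_def using O_closed by blast
    then obtain y where y: "q = \<alpha> * y" "y \<in> \<O>" unfolding e[symmetric] by (auto simp: principal_ideal_def)
    have "q \<noteq> 0" using x a by auto
    then have "x = of_rat (inverse c) * \<alpha>" using x c by (simp add: of_rat_inverse)
    then have "inverse c \<in> \<int>" using prim x by blast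
    then obtain n where n: "inverse c = of_int n" by (metis Ints_cases)
    have "of_int n = int_quad n 0 0" unfolding int_quad by simp
    then have "of_int n \<in> \<O>" using O_eq by blast
    then have "y * of_int n \<in> \<O>" using O_closed y by blast
    moreover have "of_int n = inverse q" using n c by (metis of_rat_inverse of_rat_of_int_eq)
    then have "\<alpha> * (y * of_int n) = q * inverse q" by (simp only: y(1) mult.assoc)
    then have "\<alpha> * (y * of_int n) = 1" using \<open>q \<noteq> 0\<close> by simp
    ultimately show False using a unfolding unit_group_def by blast
  qed
  then show ?thesis unfolding diff_principal_factor_def using a by blast
qed

text \<open>One period determines everything. Scaling by a power of \<open>\<epsilon>\<close> moves a minimum into \<open>(\<epsilon>, 1]\<close>, so all
  minima are \<open>\<epsilon>\<^sup>ks\<close> with \<open>s \<in> S\<close>. Norms separate the orbits of the elements of \<open>S\<close>, and since a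
  positive unit is a minimum of norm 1, its representative in \<open>S\<close> can only be 1: the positive units
  are the powers of \<open>\<epsilon>\<close>.\<close>

lemma voronoi_chain:
  assumes e: "\<epsilon> \<in> U" "0 < \<epsilon>" "\<epsilon> < 1" and S: "Mins \<inter> {\<epsilon><..1} = S" "finite S"
    and inj: "inj_on (\<lambda>\<alpha>. \<alpha> * Q \<alpha>) S" and d: "\<forall>s\<in>S. s \<noteq> 1 \<longrightarrow> diff_principal_factor K s"
  shows "fundamental_unit K \<epsilon>" "period_length K = card S" "M_chain (card S - 1) K"
    "\<forall>\<alpha>\<in>Mins. \<alpha> \<notin> U \<longrightarrow> diff_principal_factor K \<alpha>"
proof -
  have oneS: "1 \<in> S" using S(1) one_in_Mins e by auto
  have SK: "s \<in> K" if "s \<in> S" for s using that S(1) Mins_D O_sub_K by blast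
  have pow: "\<epsilon> powi k \<in> U" "\<epsilon> powi k > 0" for k using e unit_powi by auto
  have rep: "\<exists>k. \<exists>s\<in>S. \<alpha> = \<epsilon> powi k * s" if a: "\<alpha> \<in> Mins" for \<alpha>
  proof -
    have ap: "\<alpha> > 0" using Mins_D a by blast
    \<comment> \<open>the exponent with \<open>\<epsilon>\<^sup>k\<^sup>+\<^sup>1 < \<alpha> \<le> \<epsilon>\<^sup>k\<close>; both logarithms change sign because \<open>\<epsilon> < 1\<close>\<close>
    define k where "k = \<lfloor>ln \<alpha> / ln \<epsilon>\<rfloor>"
    have l: "ln \<epsilon> < 0" using e by simp
    have "real_of_int k \<le> ln \<alpha> / ln \<epsilon>" "ln \<alpha> / ln \<epsilon> < k + 1" unfolding k_def by linarith+
    then have "k * ln \<epsilon> \<ge> ln \<alpha>" "ln \<alpha> > (k + 1) * ln \<epsilon>" using l by (simp_all add: field_simps)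
    define s where "s = \<epsilon> powi (- k) * \<alpha>"
    have sM: "s \<in> Mins" unfolding s_def using unit_mult_Mins pow a by blast
    have ls: "ln s = ln \<alpha> - k * ln \<epsilon>"
      unfolding s_def using ap e by (simp add: ln_mult ln_powr flip: powr_real_of_int')
    have "ln s \<le> 0" "ln \<epsilon> < ln s"
      unfolding ls using \<open>k * ln \<epsilon> \<ge> ln \<alpha>\<close> \<open>ln \<alpha> > (k + 1) * ln \<epsilon>\<close> by (simp_all add: algebra_simps)
    then have "s \<in> S" using sM Mins_D[OF sM] e S(1) by auto
    moreover have "\<alpha> = \<epsilon> powi k * s" unfolding s_def using e by (simp add: power_int_minus)
    ultimately show ?thesis by blast
  qed
  have norm1: "s = 1" if "s \<in> S" "s \<in> U" for s
  proof -
    have "s > 0" using that S(1) e by auto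
    then have "s * Q s = 1 * Q 1" using unit_norm_1 that conj_prod_1 by simp
    then show ?thesis using inj oneS that unfolding inj_on_def by blast
  qed
  have unit_rep: "\<exists>k. u = \<epsilon> powi k" if u: "u \<in> U" "u > 0" for u
  proof -
    obtain k s where ks: "s \<in> S" "u = \<epsilon> powi k * s" using rep unit_in_Mins u by blast
    then have "s = \<epsilon> powi (- k) * u" using e by (simp add: power_int_minus)
    then have "s \<in> U" using unit_mult pow u by blast
    then have "u = \<epsilon> powi k" using norm1 ks by simp
    then show ?thesis by blast
  qed
  show "fundamental_unit K \<epsilon>"
    unfolding fundamental_unit_def
  proof (intro equalityI subsetI)
    fix u assume u: "u \<in> U"
    show "u \<in> {s * \<epsilon> powi k | s k. s \<in> {1, -1}}"
    proof (cases "u > 0")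
      case True
      then obtain k where "u = 1 * \<epsilon> powi k" using unit_rep u by auto
      then show ?thesis by blast
    next
      case False
      then have "- u > 0" using unit_nonzero u by force
      then obtain k where "- u = \<epsilon> powi k" using unit_rep unit_minus u by blast
      then have "u = -1 * \<epsilon> powi k" by simp
      then show ?thesis by blast
    qed
  next
    fix u assume "u \<in> {s * \<epsilon> powi k | s k. s \<in> {1, -1}}"
    then show "u \<in> U" using pow unit_minus by auto
  qed
  have orb: "unit_orbit K (\<epsilon> powi k * s) = unit_orbit K s" for k s
    using unit_orbit_mult pow by blast
  have orbinj: "inj_on (unit_orbit K) S"
    using inj SK unit_orbit_norm unfolding inj_on_def by blast
  have "unit_orbit K ` Mins = unit_orbit K ` S"
    using rep orb S(1) by (fastforce simp: image_iff)
  then show "period_length K = card S"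
    unfolding period_length_def using orbinj card_image by metis
  have dS: "diff_principal_factor K s \<longleftrightarrow> s \<noteq> 1" if "s \<in> S" for s
    using d that unit_1 by (auto simp: diff_principal_factor_def)
  have dM: "diff_principal_factor K (\<epsilon> powi k * s) \<longleftrightarrow> diff_principal_factor K s" for k s
  proof -
    have "\<epsilon> powi (- k) * (\<epsilon> powi k * s) = s" using e by (simp add: power_int_minus)
    then show ?thesis
      using dpf_unit_mult[OF pow, of s k] dpf_unit_mult[OF pow, of "\<epsilon> powi k * s" "- k"] by metis
  qed
  have "unit_orbit K ` {\<alpha> \<in> Mins. diff_principal_factor K \<alpha>} = unit_orbit K ` (S - {1})"
  proof (intro equalityI subsetI)
    fix X assume "X \<in> unit_orbit K ` {\<alpha> \<in> Mins. diff_principal_factor K \<alpha>}"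
    then obtain \<alpha> where a: "X = unit_orbit K \<alpha>" "\<alpha> \<in> Mins" "diff_principal_factor K \<alpha>" by blast
    obtain k s where "s \<in> S" "\<alpha> = \<epsilon> powi k * s" using rep a by blast
    then show "X \<in> unit_orbit K ` (S - {1})" using a orb dM dS by auto
  next
    fix X assume "X \<in> unit_orbit K ` (S - {1})"
    then show "X \<in> unit_orbit K ` {\<alpha> \<in> Mins. diff_principal_factor K \<alpha>}" using dS S(1) by blast
  qed
  moreover have "card (unit_orbit K ` (S - {1})) = card S - 1"
    using card_image[OF inj_on_subset[OF orbinj, of "S - {1}"]] oneS S(2) by simp
  ultimately show "M_chain (card S - 1) K" unfolding M_chain_def Let_def using S(2) by simp
  show "\<forall>\<alpha>\<in>Mins. \<alpha> \<notin> U \<longrightarrow> diff_principal_factor K \<alpha>"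
  proof (intro ballI impI)
    fix \<alpha> assume "\<alpha> \<in> Mins" "\<alpha> \<notin> U"
    moreover obtain k s where "s \<in> S" "\<alpha> = \<epsilon> powi k * s" using rep \<open>\<alpha> \<in> Mins\<close> by blast
    ultimately show "diff_principal_factor K \<alpha>" using dM dS pow by auto
  qed
qed

end
section \<open>Short vectors in three lattices\<close>

lemma abs_le_of_square_le: fixes a b::real assumes "a\<^sup>2 \<le> b\<^sup>2" "b \<ge> 0" shows "\<bar>a\<bar> \<le> b"
  using assms by (simp add: abs_le_square_iff[symmetric])

text \<open>The quadratic form is the squared modulus of the conjugate of \<open>U = x + y\<eta> + z\<phi>\<close>: its first square is
  that of the real part \<open>W\<close>, its second that of a multiple of \<open>t = y - z\<phi>/\<eta>\<close>, and \<open>C\<close> is the squared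
  modulus of the conjugate of \<open>\<eta>\<close>. The key is the linear relation
  \<open>U - W = 3/2 t\<eta> + z(M + 3\<phi>)\<close>: the bound on the form gives \<open>|t| < 1.015\<close> and \<open>|W| \<le> \<surd>C\<close>, and
  \<open>|U| < 1\<close> by hypothesis, so \<open>z\<close> is too small to be non-zero. The remaining vectors \<open>x + y\<eta>\<close> have
  \<open>|y| \<le> 1\<close>. The lemma is applied with the basis \<open>1, \<theta>, \<theta>\<^sup>2\<close> and, if \<open>b \<le> 3r\<close>, with \<open>1, \<theta>/b, \<theta>\<^sup>2/b\<close>.\<close>

lemma slab_points_are_eta:
  fixes x y z :: int and \<eta> \<phi> M C :: real
  assumes \<eta>: "0 < \<eta>" "\<eta> \<le> 1/3" and \<phi>: "\<eta>\<^sup>2 \<le> \<phi>" and M: "3 \<le> M" and C: "1 \<le> C" "C \<le> M + 1/9"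
    and u: "\<bar>x + y * \<eta> + z * \<phi>\<bar> < 1" "x + y * \<eta> + z * \<phi> \<noteq> 0"
    and Q: "(x - y * \<eta> / 2 - z * (M + \<phi> / 2))\<^sup>2 + (C - \<eta>\<^sup>2 / 4) * (y - z * (\<phi> / \<eta>))\<^sup>2 \<le> C"
  shows "\<bar>x + y * \<eta> + z * \<phi>\<bar> = \<eta>"
proof -
  define U where "U = x + y * \<eta> + z * \<phi>"
  define W where "W = x - y * \<eta> / 2 - z * (M + \<phi> / 2)"
  define t where "t = y - z * (\<phi> / \<eta>)"
  have WU: "W = U - 3/2 * (t * \<eta>) - z * (M + 3 * \<phi>)"
    using \<eta> by (simp add: U_def W_def t_def field_simps)
  have \<eta>2: "\<eta>\<^sup>2 \<le> 1/9" using power_mono[of \<eta> "1/3" 2] \<eta> by (simp add: power2_eq_square)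
  have Q': "W\<^sup>2 + (C - \<eta>\<^sup>2/4) * t\<^sup>2 \<le> C" using Q by (simp add: W_def t_def)
  have "C * (35/36) * t\<^sup>2 \<le> (C - \<eta>\<^sup>2/4) * t\<^sup>2"
    by (rule mult_right_mono) (use \<eta>2 C in auto)
  also have "\<dots> \<le> C" using Q' zero_le_power2[of W] by linarith
  finally have "t\<^sup>2 \<le> 36/35" using C by (simp add: field_simps)
  also have "\<dots> \<le> (203/200)\<^sup>2" by (simp add: power2_eq_square)
  finally have t: "\<bar>t\<bar> \<le> 203/200" by (rule abs_le_of_square_le) simp
  have "t\<^sup>2 * (C - \<eta>\<^sup>2/4) \<ge> 0" using \<eta>2 C by simp
  then have W: "W\<^sup>2 \<le> C" using Q' by (simp add: mult.commute)
  have z: "z = 0"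
  proof (rule ccontr)
    assume "z \<noteq> 0"
    then have "\<bar>real_of_int z\<bar> \<ge> 1" by linarith
    moreover have pos: "M + 3 * \<phi> > 0" using M \<phi> zero_le_power2[of \<eta>] by linarith
    ultimately have "M + 3 * \<phi> \<le> \<bar>z * (M + 3 * \<phi>)\<bar>"
      by (simp add: abs_mult mult_le_cancel_right1)
    moreover have "\<bar>t * \<eta>\<bar> \<le> 203/200 * \<eta>"
      using t \<eta> by (simp add: abs_mult mult_right_mono)
    \<comment> \<open>the worst loss against \<open>M - 1\<close>: the minimum of this quadratic, at \<open>\<eta> = 203/800\<close>. Dropping the term
    \<open>3\<eta>\<^sup>2\<close> would be too wasteful for \<open>M = 3\<close>.\<close>
    moreover have "3 * \<eta>\<^sup>2 - 3/2 * (203/200 * \<eta>) \<ge> - 194/1000"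
    proof -
      have "0 \<le> 3 * (\<eta> - 203/800)\<^sup>2" by simp
      then show ?thesis by (simp add: power2_eq_square field_simps)
    qed
    ultimately have "\<bar>W\<bar> \<ge> M - 1194/1000"
      using WU u(1) \<phi> unfolding U_def[symmetric] by linarith
    then have "(M - 1194/1000)\<^sup>2 \<le> W\<^sup>2"
      using M by (simp add: abs_le_square_iff[symmetric])
    moreover have "(M - 1194/1000)\<^sup>2 > M + 1/9"
    proof -
      have "(M - 3) * (M - 388/1000) \<ge> 0" using M by simp
      then show ?thesis by (simp add: power2_eq_square field_simps)
    qed
    ultimately show False using W C by linarith
  qed
  have ty: "t = y" by (simp add: t_def z)
  have "\<bar>real_of_int y\<bar> < 2" using t unfolding ty by linarith
  then have "y = 0 \<or> y = 1 \<or> y = -1" by linarith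
  moreover have "y \<noteq> 0" using u z by auto
  ultimately have y: "y = 1 \<or> y = -1" by simp
  then have "t\<^sup>2 = 1" using ty by auto
  then have "W\<^sup>2 \<le> (\<eta>/2)\<^sup>2" using Q' by (simp add: power_divide)
  then have "\<bar>W\<bar> \<le> \<eta>/2" by (rule abs_le_of_square_le) (use \<eta> in simp)
  moreover have "W = x - \<eta> / 2 \<or> W = x + \<eta> / 2" using y by (auto simp: W_def z)
  ultimately have "\<bar>real_of_int x\<bar> < 1" using \<eta> by linarith
  then have "x = 0" by linarith
  then show ?thesis using y z \<eta> by auto
qed

text \<open>Here the lattice is \<open>1, \<theta>, \<phi>\<close> with \<open>\<phi> = \<theta>\<^sup>2/b\<close>, \<open>R = 3r\<close> and \<open>1/\<theta> = R + \<phi>\<close>. The bound is the squared modulus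
  \<open>1/\<theta>\<^sup>2\<close> of the conjugate of \<open>\<phi>\<close>. For \<open>b \<ge> R + 1\<close> the factor of \<open>t\<^sup>2\<close> is at least \<open>R\<^sup>2 + R\<close> and exceeds
  this bound, which forces \<open>|t| < 1\<close> and excludes \<open>\<theta>\<close> itself. The relation
  \<open>U - W = 3/2 t\<theta> + z(R + 3\<phi>)\<close> then leaves \<open>|z| \<le> 1\<close>. With \<open>z = 0\<close> there is only 0; by symmetry \<open>z = 1\<close> remains, where the points
  \<open>x + y\<theta> + \<phi>\<close> other than \<open>\<phi>\<close> are seen to exceed the bound.\<close>

lemma slab_points_are_phi:
  fixes x y z :: int and b R \<theta> \<phi> :: real
  assumes R: "3 \<le> R" and b: "R + 1 \<le> b" and \<theta>: "0 < \<theta>" and \<phi>: "\<phi> = \<theta>\<^sup>2 / b"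
    and inv: "\<theta> * (R + \<phi>) = 1"
    and u: "\<bar>x + y * \<theta> + z * \<phi>\<bar> < 1" "x + y * \<theta> + z * \<phi> \<noteq> 0"
    and Q: "(x - y * \<theta> / 2 - z * (R + \<phi> / 2))\<^sup>2 + (R * b + 3 * \<theta>\<^sup>2 / 4) * (y - z * (\<theta> / b))\<^sup>2
      \<le> (R + \<phi>)\<^sup>2"
  shows "\<bar>x + y * \<theta> + z * \<phi>\<bar> = \<phi>"
proof -
  define U where "U = x + y * \<theta> + z * \<phi>"
  define W where "W = x - y * \<theta> / 2 - z * (R + \<phi> / 2)"
  define t where "t = y - z * (\<theta> / b)"
  have b0: "b \<ge> 4" "R \<ge> 3" "b \<ge> R + 1" using b R by linarith+
  have phi0: "\<phi> > 0" using \<phi> \<theta> b0 by simp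
  have th: "\<theta> < 1 / R"
  proof -
    have "\<theta> * R < \<theta> * (R + \<phi>)" using phi0 \<theta> by simp
    then show ?thesis using inv b0 by (simp add: field_simps)
  qed
  also have "1/R \<le> 1 / 3" using b0 by (simp add: field_simps)
  finally have th3: "\<theta> \<le> 1/3" by simp
  have thR: "R * \<theta> \<le> 1" using th b0 by (simp add: field_simps)
  have phi: "\<phi> \<le> 1/36" 
  proof -
    have "\<phi> \<le> \<theta>\<^sup>2 / 4" unfolding \<phi> using b0 by (intro frac_le) auto
    moreover have "\<theta>\<^sup>2 \<le> (1/3)\<^sup>2" using th3 \<theta> by (intro power_mono) auto
    ultimately show ?thesis by (simp add: power2_eq_square)
  qed
  have Rphi: "R * \<phi> \<le> 1/12"
  proof -
    have "R * \<phi> = (R * \<theta>) * (\<theta> / b)" by (simp add: \<phi> power2_eq_square)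
    also have "\<dots> \<le> 1 * (\<theta> / b)" using thR \<theta> b0 by (intro mult_right_mono) auto
    also have "\<dots> \<le> (1/3) / 4" unfolding mult_1 using th3 \<theta> b0 by (intro frac_le) auto
    finally show ?thesis by simp
  qed
  have WU: "W = U - 3/2 * (t * \<theta>) - z * (R + 3 * \<phi>)"
    by (simp add: U_def W_def t_def \<phi> field_simps power2_eq_square)
  have Q': "W\<^sup>2 + (R * b + 3 * \<theta>\<^sup>2 / 4) * t\<^sup>2 \<le> (R + \<phi>)\<^sup>2" using Q by (simp add: W_def t_def)
  have "\<phi>\<^sup>2 \<le> (1/36)\<^sup>2" using phi phi0 by (intro power_mono) auto
  then have rhs: "(R + \<phi>)\<^sup>2 \<le> R * R + 17/100" using Rphi
    by (simp add: power2_eq_square algebra_simps)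
  have RR: "R * R \<ge> 3 * R" "R * b \<ge> R * R + R"
    using b0 mult_left_mono[of "R+1" b "R"] by (simp_all add: algebra_simps)
  have S: "R * b + 3 * \<theta>\<^sup>2 / 4 \<ge> R * R + R" using RR zero_le_power2[of \<theta>] by linarith
  have t: "\<bar>t\<bar> < 1"
  proof (rule ccontr)
    assume "\<not> ?thesis"
    then have "t\<^sup>2 \<ge> 1" using abs_le_square_iff[of 1 t] by simp
    then have "(R * b + 3 * \<theta>\<^sup>2 / 4) * t\<^sup>2 \<ge> (R * R + R) * 1"
      using b0 S by (intro mult_mono) auto
    also have "\<dots> \<le> (R + \<phi>)\<^sup>2" using Q' by (rule order_trans[rotated]) simp
    finally show False using rhs b0 by simp
  qed
  have "0 \<le> (R * b + 3 * \<theta>\<^sup>2 / 4) * t\<^sup>2" using b0 by simp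
  then have "W\<^sup>2 \<le> (R + \<phi>)\<^sup>2" using Q' by linarith
  then have W: "\<bar>W\<bar> \<le> R + \<phi>" by (rule abs_le_of_square_le) (use b0 phi0 in simp)
  have thb: "\<theta> / b \<le> 1 / (R * R + R)"
  proof -
    have "\<theta> / b \<le> (1 / R) / (R + 1)" using th b0 by (intro frac_le) auto
    then show ?thesis by (simp add: algebra_simps)
  qed
  have thb2: "0 < \<theta> / b" "\<theta> / b \<le> 1/12"
  proof -
    have "R * R + R \<ge> 12" using RR(1) b0(2) by linarith
    then have "1 / (R * R + R) \<le> 1 / (12::real)" by (intro frac_le) auto
    then show "\<theta> / b \<le> 1/12" using thb by linarith
  qed (use \<theta> b0 in simp)
  have z: "\<bar>z\<bar> \<le> 1"
  proof (rule ccontr)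
    assume "\<not> ?thesis"
    then have "\<bar>real_of_int z\<bar> \<ge> 2" by linarith
    then have "2 * (R + 3 * \<phi>) \<le> \<bar>real_of_int z\<bar> * (R + 3 * \<phi>)"
      using b0 phi0 by (intro mult_right_mono) auto
    also have "\<dots> = \<bar>z * (R + 3 * \<phi>)\<bar>" using b0 phi0 by (simp add: abs_mult)
    finally have "2 * (R + 3 * \<phi>) \<le> \<bar>z * (R + 3 * \<phi>)\<bar>" .
    moreover have "\<bar>t * \<theta>\<bar> \<le> 1 * \<theta>"
      unfolding abs_mult using t \<theta> by (intro mult_mono) auto
    moreover have "\<bar>z * (R + 3 * \<phi>)\<bar> \<le> \<bar>U\<bar> + 3/2 * \<bar>t * \<theta>\<bar> + \<bar>W\<bar>"
      using WU by linarith
    moreover have "\<bar>U\<bar> < 1" using u(1) by (simp add: U_def)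
    ultimately have "2 * (R + 3 * \<phi>) < 1 + 3/2 * \<theta> + (R + \<phi>)" using W by argo
    then show False using th3 b0(2) phi0 by argo
  qed
  have one: "x = 0 \<and> y = 0" 
    if u: "\<bar>x + y * \<theta> + \<phi>\<bar> < 1" and t: "\<bar>y - \<theta> / b\<bar> < 1"
    and Q: "(x - y * \<theta> / 2 - (R + \<phi> / 2))\<^sup>2 + (R * b + 3 * \<theta>\<^sup>2 / 4) * (y - \<theta> / b)\<^sup>2
      \<le> (R + \<phi>)\<^sup>2" for x y :: int
  proof -
    have "y = 0 \<or> y = 1" using t thb2 by linarith
    moreover have "y \<noteq> 1"
    proof
      assume "y = 1"
      have "(y - \<theta> / b)\<^sup>2 \<ge> 1 - 2 / (R * R + R)"
      proof -
        have "(y - \<theta> / b)\<^sup>2 = 1 - 2 * (\<theta> / b) + (\<theta> / b)\<^sup>2"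
          by (simp add: \<open>y = 1\<close> power2_eq_square algebra_simps)
        moreover have "2 * (\<theta> / b) \<le> 2 / (R * R + R)" using thb by simp
        moreover have "0 \<le> (\<theta> / b)\<^sup>2" by (rule zero_le_power2)
        ultimately show ?thesis by argo
      qed
      moreover have "1 - 2 / (R * R + R) \<ge> 0" 
      proof -
        have "R * R + R \<ge> 2" using RR(1) b0(2) by linarith
        then show ?thesis by (simp add: field_simps)
      qed
      ultimately have "(R * R + R) * (1 - 2 / (R * R + R)) 
          \<le> (R * b + 3 * \<theta>\<^sup>2 / 4) * (y - \<theta> / b)\<^sup>2"
        using S b0 by (intro mult_mono) auto
      moreover have "(R * R + R) * (1 - 2 / (R * R + R)) = R * R + R - (2::real)"
        using b0 by (simp add: field_simps add_pos_pos less_imp_neq[THEN not_sym])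
      ultimately show False
        using Q rhs b0 zero_le_power2[of "x - y * \<theta> / 2 - (R + \<phi> / 2)"] by linarith
    qed
    ultimately have y: "y = 0" by simp
    then have "x = 0 \<or> x = -1" using u phi0 phi by simp linarith
    moreover have "x \<noteq> -1"
    proof
      assume "x = -1"
      then have "(1 + R + \<phi> / 2)\<^sup>2 \<le> (x - y * \<theta> / 2 - (R + \<phi> / 2))\<^sup>2"
        using y by (simp add: power2_eq_square algebra_simps)
      also have "\<dots> \<le> (R + \<phi>)\<^sup>2" 
      proof -
        have "0 \<le> (R * b + 3 * \<theta>\<^sup>2 / 4) * (y - \<theta> / b)\<^sup>2" using b0 by simp
        then show ?thesis using Q by linarith
      qed
      finally have "1 + R + \<phi> / 2 \<le> R + \<phi>"
        by (rule power2_le_imp_le) (use b0 phi0 in simp)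
      then show False using phi by simp
    qed
    ultimately show ?thesis using y by simp
  qed
  consider "z = 0" | "z = 1" | "z = -1" using z by linarith
  then show ?thesis
  proof cases
    case 1
    then have "y = 0" using t by (simp add: t_def)
    then show ?thesis using u 1 by auto
  next
    case 2
    then show ?thesis using one[of x y] u Q t phi0 by (simp add: t_def)
  next
    case 3
    have "- x = 0 \<and> - y = 0"
    proof (rule one)
      show "\<bar>(- x) + (- y) * \<theta> + \<phi>\<bar> < 1" using u 3 by simp
      show "\<bar>(-y) - \<theta> / b\<bar> < 1" using t 3 by (simp add: t_def)
      have e1: "((- x) - (- y) * \<theta> / 2 - (R + \<phi> / 2))\<^sup>2 = (x - y * \<theta> / 2 - z * (R + \<phi> / 2))\<^sup>2"
        by (simp add: 3 power2_eq_square algebra_simps)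
      have e2: "((- y) - \<theta> / b)\<^sup>2 = (y - z * (\<theta> / b))\<^sup>2"
        by (simp add: 3 power2_eq_square algebra_simps)
      show "((- x) - (- y) * \<theta> / 2 - (R + \<phi> / 2))\<^sup>2
          + (R * b + 3 * \<theta>\<^sup>2 / 4) * ((- y) - \<theta> / b)\<^sup>2 \<le> (R + \<phi>)\<^sup>2"
        unfolding e1 e2 by (rule Q)
    qed
    then show ?thesis using 3 phi0 by simp
  qed
qed

text \<open>The same lattice as before, but for \<open>b \<le> R\<close> and with the bound \<open>Rb + \<theta>\<^sup>2\<close>, the squared modulus \<open>b/\<theta>\<close> of
  the conjugate of \<open>\<theta>\<close>. Again \<open>|z| \<le> 1\<close>, and every vector with \<open>z = 1\<close> exceeds the bound: for \<open>y = 0\<close>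
  and \<open>y = 1\<close> because \<open>W\<^sup>2 \<ge> R\<^sup>2 \<ge> Rb\<close>, where the imaginary part supplies the missing \<open>\<theta>\<^sup>2\<close>, and for
  \<open>y = -1\<close> by the imaginary part alone, since then \<open>|t| > 1\<close>. So the solutions have \<open>z = 0\<close>, and among
  the vectors \<open>x + y\<theta>\<close> only \<open>\<plusminus>\<theta>\<close> are small enough.\<close>

lemma slab_points_are_theta:
  fixes x y z :: int and b R \<theta> \<phi> :: real
  assumes R: "3 \<le> R" and b: "2 \<le> b" "b \<le> R" and \<theta>: "0 < \<theta>" and \<phi>: "\<phi> = \<theta>\<^sup>2 / b"
    and inv: "\<theta> * (R + \<phi>) = 1"
    and u: "\<bar>x + y * \<theta> + z * \<phi>\<bar> < 1" "x + y * \<theta> + z * \<phi> \<noteq> 0"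
    and Q: "(x - y * \<theta> / 2 - z * (R + \<phi> / 2))\<^sup>2 + (R * b + 3 * \<theta>\<^sup>2 / 4) * (y - z * (\<theta> / b))\<^sup>2
      \<le> R * b + \<theta>\<^sup>2"
  shows "\<bar>x + y * \<theta> + z * \<phi>\<bar> = \<theta>"
proof -
  define U where "U = x + y * \<theta> + z * \<phi>"
  define W where "W = x - y * \<theta> / 2 - z * (R + \<phi> / 2)"
  define t where "t = y - z * (\<theta> / b)"
  have b0: "b \<ge> 2" "R \<ge> 3" "b \<le> R" using b R by linarith+
  have phi0: "\<phi> > 0" using \<phi> \<theta> b0 by simp
  have th: "\<theta> < 1 / R"
  proof -
    have "\<theta> * R < \<theta> * (R + \<phi>)" using phi0 \<theta> by simp
    then show ?thesis using inv b0 by (simp add: field_simps)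
  qed
  also have "1/R \<le> 1 / 3" using b0 by (simp add: field_simps)
  finally have th3: "\<theta> \<le> 1/3" by simp
  have th2: "\<theta>\<^sup>2 \<le> 1/9" using power_mono[of \<theta> "1/3" 2] th3 \<theta> by (simp add: power2_eq_square)
  have phi: "\<phi> \<le> 1/18" 
  proof -
    have "\<phi> \<le> \<theta>\<^sup>2 / 2" unfolding \<phi> using b0 by (intro frac_le) auto
    then show ?thesis using th2 by simp
  qed
  have WU: "W = U - 3/2 * (t * \<theta>) - z * (R + 3 * \<phi>)"
    by (simp add: U_def W_def t_def \<phi> field_simps power2_eq_square)
  have Q': "W\<^sup>2 + (R * b + 3 * \<theta>\<^sup>2 / 4) * t\<^sup>2 \<le> R * b + \<theta>\<^sup>2" using Q by (simp add: W_def t_def)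
  have Rb: "R * b \<le> R * R" "R * b \<ge> 6"
    using b0 mult_mono[of 3 "R" 2 "b"] by (auto intro: mult_left_mono)
  have thb: "0 < \<theta> / b" "\<theta> / b \<le> 1/6"
  proof -
    have "\<theta> / b \<le> (1/3) / 2" using th3 \<theta> b0 by (intro frac_le) auto
    then show "\<theta> / b \<le> 1/6" by simp
  qed (use \<theta> b0 in simp)
  have t: "\<bar>t\<bar> \<le> 203/200"
  proof -
    have "(R * b) * t\<^sup>2 \<le> (R * b + 3 * \<theta>\<^sup>2 / 4) * t\<^sup>2" by (intro mult_right_mono) auto
    also have "\<dots> \<le> R * b + \<theta>\<^sup>2" using Q' zero_le_power2[of W] by linarith
    also have "\<dots> \<le> (R * b) * (55/54)" using Rb th2 by simp
    finally have "t\<^sup>2 \<le> 55/54" using Rb by (subst (asm) mult_le_cancel_left_pos) auto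
    also have "\<dots> \<le> (203/200)\<^sup>2" by (simp add: power2_eq_square)
    finally show ?thesis by (rule abs_le_of_square_le) simp
  qed
  have St: "0 \<le> (R * b + 3 * \<theta>\<^sup>2 / 4) * t\<^sup>2" using Rb by simp
  \<comment> \<open>since \<open>(R + 1/54)\<^sup>2 \<ge> R\<^sup>2 + R/27\<close> with \<open>R \<ge> 3\<close>, and \<open>\<theta>\<^sup>2 \<le> 1/9\<close>\<close>
  have W: "\<bar>W\<bar> \<le> R + 1/54"
  proof (rule abs_le_of_square_le)
    have "W\<^sup>2 \<le> R * R + 1/9" using Q' St Rb th2 by linarith
    also have "\<dots> \<le> (R + 1/54)\<^sup>2" using b0 by (simp add: power2_eq_square algebra_simps)
    finally show "W\<^sup>2 \<le> (R + 1/54)\<^sup>2" .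
  qed (use b0 in simp)
  have z: "\<bar>z\<bar> \<le> 1"
  proof (rule ccontr)
    assume "\<not> ?thesis"
    then have "\<bar>real_of_int z\<bar> \<ge> 2" by linarith
    then have "2 * (R + 3 * \<phi>) \<le> \<bar>real_of_int z\<bar> * (R + 3 * \<phi>)"
      using b0 phi0 by (intro mult_right_mono) auto
    also have "\<dots> = \<bar>z * (R + 3 * \<phi>)\<bar>" using b0 phi0 by (simp add: abs_mult)
    finally have "2 * (R + 3 * \<phi>) \<le> \<bar>z * (R + 3 * \<phi>)\<bar>" .
    moreover have "\<bar>t * \<theta>\<bar> \<le> 203/200 * \<theta>"
      unfolding abs_mult using t \<theta> by (intro mult_mono) auto
    moreover have "\<bar>z * (R + 3 * \<phi>)\<bar> \<le> \<bar>U\<bar> + 3/2 * \<bar>t * \<theta>\<bar> + \<bar>W\<bar>"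
      using WU by linarith
    moreover have "\<bar>U\<bar> < 1" using u(1) by (simp add: U_def)
    ultimately have "2 * (R + 3 * \<phi>) < 1 + 3/2 * (203/200 * \<theta>) + (R + 1/54)" using W by argo
    then show False using th3 b0(2) phi0 by argo
  qed
  have one: False
    if u: "\<bar>x + y * \<theta> + \<phi>\<bar> < 1" and t: "\<bar>y - \<theta> / b\<bar> \<le> 203/200"
    and Q: "(x - y * \<theta> / 2 - (R + \<phi> / 2))\<^sup>2 + (R * b + 3 * \<theta>\<^sup>2 / 4) * (y - \<theta> / b)\<^sup>2
      \<le> R * b + \<theta>\<^sup>2" for x y :: int
  proof -
    have "y = 0 \<or> y = 1 \<or> y = -1" using t thb by linarith
    then consider "y = 0" | "y = 1" | "y = -1" by blast
    then show False
    proof cases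
      case 1
      then have x: "x \<le> 0" using u phi0 by simp
      have "(R + \<phi> / 2)\<^sup>2 \<le> (x - y * \<theta> / 2 - (R + \<phi> / 2))\<^sup>2"
        using 1 x phi0 b0 by (simp add: abs_le_square_iff[symmetric])
      moreover have "(R + \<phi> / 2)\<^sup>2 \<ge> R * R + R * \<phi>"
        by (simp add: power2_eq_square algebra_simps)
      moreover have "(R * b + 3 * \<theta>\<^sup>2 / 4) * (y - \<theta> / b)\<^sup>2 \<ge> R * \<phi>"
      proof -
        have "R * \<phi> = (R * b) * (y - \<theta> / b)\<^sup>2"
          using 1 b0 by (simp add: \<phi> power2_eq_square)
        also have "\<dots> \<le> (R * b + 3 * \<theta>\<^sup>2 / 4) * (y - \<theta> / b)\<^sup>2" by (intro mult_right_mono) auto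
        finally show ?thesis .
      qed
      moreover have "R * \<phi> \<ge> \<theta>\<^sup>2"
      proof -
        have "R * \<phi> = (R / b) * \<theta>\<^sup>2" by (simp add: \<phi>)
        moreover have "R / b \<ge> 1" using b0 by simp
        ultimately show ?thesis by (metis mult_1 mult_right_mono zero_le_power2)
      qed
      moreover have "\<theta>\<^sup>2 > 0" using \<theta> by simp
      ultimately show False using Q Rb by linarith
    next
      case 2
      then have x: "x \<le> 0" using u phi0 \<theta> by simp
      have "(R)\<^sup>2 \<le> (x - y * \<theta> / 2 - (R + \<phi> / 2))\<^sup>2"
        using 2 x phi0 b0 \<theta> by (simp add: abs_le_square_iff[symmetric])
      moreover have "R * b + 3 * \<theta>\<^sup>2 / 4 \<ge> 6" using Rb zero_le_power2[of \<theta>] by linarith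
      then have "(R * b + 3 * \<theta>\<^sup>2 / 4) * (y - \<theta> / b)\<^sup>2 \<ge> 6 * (5/6)\<^sup>2"
        using 2 thb by (intro mult_mono power_mono) auto
      ultimately show False using Q Rb th2 by (simp add: power2_eq_square)
    next
      case 3
      have "(y - \<theta> / b)\<^sup>2 \<ge> 1 + 2 * (\<theta> / b)"
        using zero_le_power2[of "\<theta> / b"] unfolding power2_diff by (simp add: 3)
      then have "(R * b + 3 * \<theta>\<^sup>2 / 4) * (y - \<theta> / b)\<^sup>2 \<ge> (R * b + 3 * \<theta>\<^sup>2 / 4) * (1 + 2 * (\<theta> / b))"
        using Rb by (intro mult_left_mono) auto
      moreover have "(R * b + 3 * \<theta>\<^sup>2 / 4) * (1 + 2 * (\<theta> / b))
          = R * b + 3 * \<theta>\<^sup>2 / 4 + 2 * R * \<theta> + 3 * \<theta>\<^sup>2 / 4 * (2 * (\<theta> / b))"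
        using b0 by (simp add: field_simps)
      moreover have "3 * \<theta>\<^sup>2 / 4 * (2 * (\<theta> / b)) \<ge> 0" using thb(1) by (intro mult_nonneg_nonneg) auto
      moreover have "R * \<theta> \<ge> 3 * \<theta>" using b0 \<theta> by simp
      moreover have "\<theta>\<^sup>2 \<le> \<theta>"
        using th3 \<theta> by (simp add: power2_eq_square mult_left_le)
      ultimately have "R * b + 6 * \<theta> \<le> (R * b + 3 * \<theta>\<^sup>2 / 4) * (y - \<theta> / b)\<^sup>2"
        using zero_le_power2[of \<theta>] by argo
      also have "\<dots> \<le> R * b + \<theta>\<^sup>2" using Q by (rule order_trans[rotated]) simp
      finally show False using \<open>\<theta>\<^sup>2 \<le> \<theta>\<close> \<theta> by simp
    qed
  qed
  consider "z = 0" | "z = 1" | "z = -1" using z by linarith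
  then show ?thesis
  proof cases
    case 1
    have ty: "t = y" by (simp add: t_def 1)
    have "\<bar>real_of_int y\<bar> < 2" using t unfolding ty by linarith
    then have "y = 0 \<or> y = 1 \<or> y = -1" by linarith
    moreover have "y \<noteq> 0" using u 1 by auto
    ultimately have y: "y = 1 \<or> y = -1" by simp
    then have "t\<^sup>2 = 1" using ty by auto
    then have "W\<^sup>2 \<le> (\<theta>/2)\<^sup>2" using Q' by (simp add: power_divide)
    then have "\<bar>W\<bar> \<le> \<theta>/2" by (rule abs_le_of_square_le) (use \<theta> in simp)
    moreover have "W = x - \<theta> / 2 \<or> W = x + \<theta> / 2" using y by (auto simp: W_def 1)
    ultimately have "\<bar>real_of_int x\<bar> < 1" using \<theta> th3 by linarith
    then have "x = 0" by linarith
    then show ?thesis using y 1 \<theta> by auto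
  next
    case 2
    then show ?thesis using one[of x y] u Q t by (simp add: t_def)
  next
    case 3
    have False
    proof (rule one)
      show "\<bar>(- x) + (- y) * \<theta> + \<phi>\<bar> < 1" using u 3 by simp
      show "\<bar>(-y) - \<theta> / b\<bar> \<le> 203/200"
      proof -
        have "(- y) - \<theta> / b = - t" by (simp add: t_def 3)
        then show ?thesis using t by (simp only: abs_minus_cancel)
      qed
      have e1: "((- x) - (- y) * \<theta> / 2 - (R + \<phi> / 2))\<^sup>2 = (x - y * \<theta> / 2 - z * (R + \<phi> / 2))\<^sup>2"
        by (simp add: 3 power2_eq_square algebra_simps)
      have e2: "((- y) - \<theta> / b)\<^sup>2 = (y - z * (\<theta> / b))\<^sup>2"
        by (simp add: 3 power2_eq_square algebra_simps)
      show "((- x) - (- y) * \<theta> / 2 - (R + \<phi> / 2))\<^sup>2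
          + (R * b + 3 * \<theta>\<^sup>2 / 4) * ((- y) - \<theta> / b)\<^sup>2 \<le> R * b + \<theta>\<^sup>2"
        unfolding e1 e2 by (rule Q)
    qed
    then show ?thesis ..
  qed
qed
section \<open>The family X^3 + 3rbX - b\<close>

locale cubic_family = monogenic_depressed_cubic "3 * r * b" b \<theta> for r b :: int and \<theta> :: real +
  assumes r_ge_1: "r \<ge> 1" and b_ge_1: "b \<ge> 1"
begin

definition \<epsilon> :: real where "\<epsilon> = 1 - 3 * r * \<theta>"

lemma r_b_real: "real_of_int r \<ge> 1" "real_of_int b \<ge> 1"
  using r_ge_1 b_ge_1 by simp_all

lemma theta_cube: "\<theta> ^ 3 = b * \<epsilon>"
  using root by (simp add: \<epsilon>_def algebra_simps)

lemma theta_pos: "\<theta> > 0"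
proof -
  have "\<theta> * (\<theta>\<^sup>2 + 3 * r * b) = b"
    using root by (simp add: power2_eq_square power3_eq_cube algebra_simps)
  then have "\<theta> * (\<theta>\<^sup>2 + 3 * r * b) > 0" using r_b_real by simp
  moreover have "\<theta>\<^sup>2 + 3 * r * b > 0" using r_b_real by (intro add_nonneg_pos) auto
  ultimately show ?thesis using zero_less_mult_pos2 by blast
qed

lemma eps_bounds: "0 < \<epsilon>" "\<epsilon> < 1"
proof -
  have "b * \<epsilon> > 0" using theta_cube theta_pos by (metis zero_less_power)
  then show "0 < \<epsilon>" using r_b_real by (simp add: zero_less_mult_iff)
  show "\<epsilon> < 1" using r_b_real theta_pos by (simp add: \<epsilon>_def)
qed

lemma theta_le: "\<theta> \<le> 1/3"
proof -
  have "3 * 1 * \<theta> \<le> 3 * r * \<theta>" using r_b_real theta_pos by (intro mult_right_mono) auto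
  then show ?thesis using eps_bounds by (simp add: \<epsilon>_def)
qed

text \<open>The shape \<open>1/\<theta> = 3r + \<theta>\<^sup>2/b\<close> explains the lattices below: division by \<open>\<theta>\<close> only introduces the
  denominator \<open>b\<close> at \<open>\<theta>\<^sup>2\<close>.\<close>

lemma inverse_theta: "\<theta> * (3 * r + \<theta>\<^sup>2 / b) = 1"
proof -
  have "\<theta> * (3 * r + \<theta>\<^sup>2 / b) = 3 * r * \<theta> + \<theta> ^ 3 / b"
    by (simp add: power2_eq_square power3_eq_cube algebra_simps)
  also have "\<dots> = 1" unfolding theta_cube using r_b_real by (simp add: \<epsilon>_def)
  finally show ?thesis .
qed

lemma theta_in_O: "\<theta> \<in> \<O>" and theta2_in_O: "\<theta>\<^sup>2 \<in> \<O>" and eps_in_O: "\<epsilon> \<in> \<O>"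
proof -
  have "\<theta> = int_quad 0 1 0" "\<theta>\<^sup>2 = int_quad 0 0 1" "\<epsilon> = int_quad 1 (- 3 * r) 0" unfolding int_quad \<epsilon>_def by simp_all
  then show "\<theta> \<in> \<O>" "\<theta>\<^sup>2 \<in> \<O>" "\<epsilon> \<in> \<O>" using O_eq by blast+
qed

text \<open>The inverse is the product \<open>1 + 3r\<theta> + 9r\<^sup>2(\<theta>\<^sup>2 + 3rb)\<close> of the complex conjugates of \<open>\<epsilon>\<close>.\<close>

lemma eps_unit: "\<epsilon> \<in> U"
proof -
  have "int_quad (1 + 27 * r ^ 3 * b) (3 * r) (9 * r\<^sup>2) \<in> \<O>" using O_eq by blast
  moreover have "\<epsilon> * int_quad (1 + 27 * r ^ 3 * b) (3 * r) (9 * r\<^sup>2) = 1"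
  proof -
    have "\<epsilon> * int_quad (1 + 27 * r ^ 3 * b) (3 * r) (9 * r\<^sup>2) = 1 + 27 * r ^ 3 * (b * \<epsilon>) - 27 * r ^ 3 * \<theta> ^ 3"
      unfolding int_quad \<epsilon>_def by (simp add: power2_eq_square power3_eq_cube algebra_simps)
    then show ?thesis unfolding theta_cube by simp
  qed
  ultimately show ?thesis unfolding unit_group_def using eps_in_O by blast
qed

lemma Q_theta: "Q \<theta> = b / \<theta>" and Q_theta_eq: "Q \<theta> = 3 * r * b + \<theta>\<^sup>2"
proof -
  have "Q \<theta> = conj_form 0 1 0" using conj_prod_quad[of 0 1 0] by (simp add: quad_def)
  then show e: "Q \<theta> = 3 * r * b + \<theta>\<^sup>2" by (simp add: conj_form_def power_divide)
  have "\<theta> * Q \<theta> = b" unfolding e using root 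
    by (simp add: power2_eq_square power3_eq_cube algebra_simps)
  then show "Q \<theta> = b / \<theta>" using theta_pos by (simp add: field_simps)
qed

lemma Q_theta2: "Q (\<theta>\<^sup>2) = (b / \<theta>)\<^sup>2"
  using conj_prod_mult[of \<theta> \<theta>] theta_in_K by (simp add: power2_eq_square Q_theta)

lemma Q_eps: "Q \<epsilon> = 1 / \<epsilon>"
  using unit_norm_1[OF eps_unit eps_bounds(1)] eps_bounds by (simp add: field_simps)

lemma eps_eq: "\<epsilon> = \<theta> ^ 3 / b"
  using theta_cube r_b_real by simp

lemma gap_1_theta:
  assumes n: "\<nu> \<in> \<O>" "\<nu> \<noteq> 0" "\<bar>\<nu>\<bar> < 1" "Q \<nu> \<le> Q \<theta>"
  shows "\<bar>\<nu>\<bar> = \<theta>"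
proof -
  obtain x y z where v: "\<nu> = int_quad x y z" using n O_eq by blast
  have p: "real_of_int (3 * r * b) \<ge> 3" using mult_mono[of 1 "real_of_int r" 1 "real_of_int b"] r_b_real by simp
  have t2: "\<theta>\<^sup>2 \<le> 1/9" using power_mono[of \<theta> "1/3" 2] theta_le theta_pos by (simp add: power2_eq_square)
  have "\<bar>x + y * \<theta> + z * \<theta>\<^sup>2\<bar> = \<theta>"
  proof (rule slab_points_are_eta)
    show "0 < \<theta>" "\<theta> \<le> 1/3" "\<theta>\<^sup>2 \<le> \<theta>\<^sup>2" using theta_pos theta_le by auto
    show "3 \<le> real_of_int (3 * r * b)" by fact
    show "1 \<le> 3 * r * b + \<theta>\<^sup>2" using p zero_le_power2[of \<theta>] by linarith
    show "3 * r * b + \<theta>\<^sup>2 \<le> real_of_int (3 * r * b) + 1/9" using t2 by simp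
    show "\<bar>x + y * \<theta> + z * \<theta>\<^sup>2\<bar> < 1" "x + y * \<theta> + z * \<theta>\<^sup>2 \<noteq> 0" using n by (simp_all add: v int_quad)
    have "conj_form x y z \<le> 3 * r * b + \<theta>\<^sup>2"
      using n(4) unfolding v conj_prod_quad Q_theta_eq by simp
    moreover have "3 * r * b + \<theta>\<^sup>2 - \<theta>\<^sup>2 / 4 = 3 * r * b + 3 * \<theta>\<^sup>2 / 4" by simp
    moreover have "\<theta>\<^sup>2 / \<theta> = \<theta>" using theta_pos by (simp add: power2_eq_square)
    ultimately show "(x - y * \<theta> / 2 - z * (real_of_int (3 * r * b) + \<theta>\<^sup>2 / 2))\<^sup>2
        + (3 * r * b + \<theta>\<^sup>2 - \<theta>\<^sup>2 / 4) * (y - z * (\<theta>\<^sup>2 / \<theta>))\<^sup>2 \<le> 3 * r * b + \<theta>\<^sup>2"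
      by (simp only: conj_form_def)
  qed
  then show ?thesis by (simp add: v int_quad)
qed

lemma div_theta:
  assumes "\<nu> \<in> \<O>"
  obtains x y z :: int where "\<nu> = \<theta> * quad (of_int x, of_int y, of_int z / of_int b) \<theta>"
proof -
  obtain x y z where v: "\<nu> = int_quad x y z" using assms O_eq by blast
  have "\<theta> * quad (of_int (y + 3 * r * x), of_int z, of_int x / of_int b) \<theta>
      = y * \<theta> + z * \<theta>\<^sup>2 + x * (\<theta> * (3 * r + \<theta>\<^sup>2 / b))"
    by (simp add: quad_def of_rat_divide of_rat_add of_rat_mult power2_eq_square algebra_simps)
  then have "\<nu> = \<theta> * quad (of_int (y + 3 * r * x), of_int z, of_int x / of_int b) \<theta>"
    unfolding inverse_theta v int_quad by simp
  then show ?thesis using that by blast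
qed

lemma div_theta2:
  assumes "\<nu> \<in> \<O>"
  obtains x y z :: int where "\<nu> = \<theta>\<^sup>2 * quad (of_int x, of_int y / of_int b, of_int z / of_int b) \<theta>"
proof -
  obtain x y z where v: "\<nu> = \<theta> * quad (of_int x, of_int y, of_int z / of_int b) \<theta>"
    using div_theta assms by blast
  have "\<theta> * quad (of_int (y + 3 * r * x), of_int z / of_int b, of_int x / of_int b) \<theta>
      = y * \<theta> + z / b * \<theta>\<^sup>2 + x * (\<theta> * (3 * r + \<theta>\<^sup>2 / b))"
    by (simp add: quad_def of_rat_divide of_rat_add of_rat_mult power2_eq_square algebra_simps)
  also have "\<dots> = quad (of_int x, of_int y, of_int z / of_int b) \<theta>"
    unfolding inverse_theta by (simp add: quad_def of_rat_divide)
  finally have "\<nu> = \<theta>\<^sup>2 * quad (of_int (y + 3 * r * x), of_int z / of_int b, of_int x / of_int b) \<theta>"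
    unfolding v by (simp add: power2_eq_square mult.assoc)
  then show ?thesis using that by blast
qed

lemma conj_form_div_b:
  "conj_form x y (z / b) = (x - y * \<theta> / 2 - z * (3 * r + \<theta>\<^sup>2 / b / 2))\<^sup>2
     + (3 * r * b + 3 * \<theta>\<^sup>2 / 4) * (y - z * (\<theta> / b))\<^sup>2"
proof -
  have "z / b * (3 * r * b + \<theta>\<^sup>2 / 2) = z * (3 * r + \<theta>\<^sup>2 / b / 2)" using r_b_real by (simp add: field_simps)
  then show ?thesis by (simp add: conj_form_def)
qed

text \<open>For \<open>\<nu> = \<theta>\<mu>\<close> the two conditions become \<open>|\<mu>| < 1\<close> and \<open>|\<mu>'|\<^sup>2 \<le> 1/\<theta>\<^sup>2\<close>, with \<open>\<mu>\<close> in the lattice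
  \<open>1, \<theta>, \<theta>\<^sup>2/b\<close>.\<close>

lemma gap_theta_eps:
  assumes b: "b > 3 * r" and n: "\<nu> \<in> \<O>" "\<nu> \<noteq> 0" "\<bar>\<nu>\<bar> < \<theta>" "Q \<nu> \<le> Q \<epsilon>"
  shows "\<bar>\<nu>\<bar> = \<epsilon>"
proof -
  obtain x y z where v: "\<nu> = \<theta> * quad (of_int x, of_int y, of_int z / of_int b) \<theta>" (is "\<nu> = \<theta> * ?\<mu>")
    using n div_theta by blast
  have mu: "?\<mu> = x + y * \<theta> + z * (\<theta>\<^sup>2 / b)" by (simp add: quad_def of_rat_divide)
  have inv: "3 * r + \<theta>\<^sup>2 / b = 1 / \<theta>" using inverse_theta theta_pos by (simp add: field_simps)
  have "Q \<nu> = b / \<theta> * Q ?\<mu>" unfolding v using conj_prod_mult[OF theta_in_K quad_in_K] Q_theta by simp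
  also have "Q ?\<mu> = conj_form x y (z / b)" unfolding conj_prod_quad by (simp add: of_rat_divide)
  finally have "b / \<theta> * conj_form x y (z / b) \<le> b / \<theta> * (1 / \<theta>)\<^sup>2"
    using n(4) unfolding Q_eps unfolding eps_eq by (simp add: power2_eq_square power3_eq_cube mult_ac)
  then have c: "conj_form x y (z / b) \<le> (3 * r + \<theta>\<^sup>2 / b)\<^sup>2"
    unfolding inv using theta_pos r_b_real by (subst (asm) mult_le_cancel_left_pos) auto
  have "\<bar>?\<mu>\<bar> = \<theta>\<^sup>2 / b"
    unfolding mu
  proof (rule slab_points_are_phi)
    show "3 \<le> 3 * real_of_int r" "3 * real_of_int r + 1 \<le> b" using b r_b_real by linarith+
    show "0 < \<theta>" by (rule theta_pos)
    show "\<theta> * (3 * real_of_int r + \<theta>\<^sup>2 / b) = 1" using inverse_theta by simp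
    show "\<bar>x + y * \<theta> + z * (\<theta>\<^sup>2 / b)\<bar> < 1"
      using n(3) theta_pos unfolding v mu abs_mult by simp
    show "x + y * \<theta> + z * (\<theta>\<^sup>2 / b) \<noteq> 0" using n(2) unfolding v mu by simp
  qed (use c in \<open>simp_all add: conj_form_div_b\<close>)
  then show ?thesis using theta_pos unfolding v abs_mult eps_eq
    by (simp add: power2_eq_square power3_eq_cube)
qed

text \<open>As before with \<open>\<nu> = \<theta>\<mu>\<close>, but now \<open>|\<mu>'|\<^sup>2 \<le> b/\<theta>\<close>.\<close>

lemma gap_theta_theta2:
  assumes b: "2 \<le> b" "b \<le> 3 * r" and n: "\<nu> \<in> \<O>" "\<nu> \<noteq> 0" "\<bar>\<nu>\<bar> < \<theta>" "Q \<nu> \<le> Q (\<theta>\<^sup>2)"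
  shows "\<bar>\<nu>\<bar> = \<theta>\<^sup>2"
proof -
  obtain x y z where v: "\<nu> = \<theta> * quad (of_int x, of_int y, of_int z / of_int b) \<theta>" (is "\<nu> = \<theta> * ?\<mu>")
    using n div_theta by blast
  have mu: "?\<mu> = x + y * \<theta> + z * (\<theta>\<^sup>2 / b)" by (simp add: quad_def of_rat_divide)
  have "Q \<nu> = b / \<theta> * Q ?\<mu>" unfolding v using conj_prod_mult[OF theta_in_K quad_in_K] Q_theta by simp
  also have "Q ?\<mu> = conj_form x y (z / b)" unfolding conj_prod_quad by (simp add: of_rat_divide)
  finally have "b / \<theta> * conj_form x y (z / b) \<le> b / \<theta> * Q \<theta>"
    using n(4) unfolding Q_theta2 Q_theta by (simp add: power2_eq_square)
  then have c: "conj_form x y (z / b) \<le> 3 * r * b + \<theta>\<^sup>2"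
    unfolding Q_theta_eq using theta_pos r_b_real by (subst (asm) mult_le_cancel_left_pos) auto
  have "\<bar>?\<mu>\<bar> = \<theta>"
    unfolding mu
  proof (rule slab_points_are_theta)
    show "3 \<le> 3 * real_of_int r" "2 \<le> real_of_int b" "b \<le> 3 * real_of_int r" using b r_b_real by linarith+
    show "0 < \<theta>" by (rule theta_pos)
    show "\<theta> * (3 * real_of_int r + \<theta>\<^sup>2 / b) = 1" using inverse_theta by simp
    show "\<bar>x + y * \<theta> + z * (\<theta>\<^sup>2 / b)\<bar> < 1"
      using n(3) theta_pos unfolding v mu abs_mult by simp
    show "x + y * \<theta> + z * (\<theta>\<^sup>2 / b) \<noteq> 0" using n(2) unfolding v mu by simp
  qed (use c in \<open>simp_all add: conj_form_div_b\<close>)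
  then show ?thesis using theta_pos unfolding v abs_mult
    by (simp add: power2_eq_square)
qed

text \<open>For \<open>\<nu> = \<theta>\<^sup>2\<mu>\<close> the conditions become \<open>|\<mu>| < 1\<close> and \<open>|\<mu>'|\<^sup>2 \<le> 1/(b\<theta>)\<close>, with \<open>\<mu>\<close> in the lattice
  \<open>1, \<theta>/b, \<theta>\<^sup>2/b\<close>; the bound is the squared modulus of the conjugate of \<open>\<theta>/b\<close>.\<close>

lemma gap_theta2_eps:
  assumes b: "b \<le> 3 * r" and n: "\<nu> \<in> \<O>" "\<nu> \<noteq> 0" "\<bar>\<nu>\<bar> < \<theta>\<^sup>2" "Q \<nu> \<le> Q \<epsilon>"
  shows "\<bar>\<nu>\<bar> = \<epsilon>"
proof -
  obtain x y z where v: "\<nu> = \<theta>\<^sup>2 * quad (of_int x, of_int y / of_int b, of_int z / of_int b) \<theta>"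
    (is "\<nu> = \<theta>\<^sup>2 * ?\<mu>") using n div_theta2 by blast
  define \<eta> \<phi> where "\<eta> = \<theta> / b" and "\<phi> = \<theta>\<^sup>2 / b"
  have mu: "?\<mu> = x + y * \<eta> + z * \<phi>" by (simp add: quad_def of_rat_divide \<eta>_def \<phi>_def)
  have b1: "real_of_int b \<ge> 1" "real_of_int b \<le> 3 * r" using r_b_real b by linarith+
  have inv: "3 * r + \<phi> = 1 / \<theta>" unfolding \<phi>_def using inverse_theta theta_pos by (simp add: field_simps)
  have t2: "\<theta>\<^sup>2 \<le> 1/9" using power_mono[of \<theta> "1/3" 2] theta_le theta_pos by (simp add: power2_eq_square)
  have phi: "0 < \<phi>" "\<phi> \<le> 1/9"
    using b1 t2 theta_pos frac_le[of "\<theta>\<^sup>2" "1/9" 1 "real_of_int b"] by (simp_all add: \<phi>_def)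
  define C where "C = (3 * r + \<phi>) / b"
  have C: "C = (3 * r * b + \<theta>\<^sup>2) / b\<^sup>2"
  proof -
    have "3 * r + \<phi> = (3 * r * b + \<theta>\<^sup>2) / b" using b1 by (simp add: \<phi>_def add_divide_distrib)
    then show ?thesis by (simp add: C_def power2_eq_square)
  qed
  have "Q \<nu> = (b / \<theta>)\<^sup>2 * Q ?\<mu>"
    unfolding v using conj_prod_mult[OF O_sub_K[OF theta2_in_O] quad_in_K] Q_theta2 by simp
  also have "Q ?\<mu> = conj_form x (y / b) (z / b)" unfolding conj_prod_quad by (simp add: of_rat_divide)
  finally have "(b / \<theta>)\<^sup>2 * conj_form x (y / b) (z / b) \<le> (b / \<theta>)\<^sup>2 * C"
    using n(4) b1 theta_pos unfolding Q_eps C_def inv unfolding eps_eq by (simp add: power2_eq_square power3_eq_cube mult_ac)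
  then have c: "conj_form x (y / b) (z / b) \<le> C"
    using theta_pos b1 by (subst (asm) mult_le_cancel_left_pos) auto
  have "\<bar>?\<mu>\<bar> = \<eta>"
    unfolding mu
  proof (rule slab_points_are_eta)
    show "0 < \<eta>" "\<eta> \<le> 1/3"
      using theta_pos b1 theta_le frac_le[of \<theta> "1/3" 1 "real_of_int b"] by (simp_all add: \<eta>_def)
    show "\<eta>\<^sup>2 \<le> \<phi>"
      using b1 theta_pos by (simp add: \<eta>_def \<phi>_def power2_eq_square field_simps)
    show "3 \<le> 3 * real_of_int r" using r_b_real by simp
    show "1 \<le> C" using b1 phi by (simp add: C_def)
    show "C \<le> 3 * real_of_int r + 1/9"
    proof -
      have "C \<le> (3 * r + \<phi>) / 1" unfolding C_def using b1 phi by (intro frac_le) auto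
      then show ?thesis using phi by simp
    qed
    show "\<bar>x + y * \<eta> + z * \<phi>\<bar> < 1"
      using n(3) theta_pos unfolding v mu abs_mult by simp
    show "x + y * \<eta> + z * \<phi> \<noteq> 0" using n(2) unfolding v mu by simp
    have "C - \<eta>\<^sup>2 / 4 = (3 * r * b + 3 * \<theta>\<^sup>2 / 4) / b\<^sup>2"
    proof -
      have "C - \<eta>\<^sup>2 / 4 = (3 * r * b + \<theta>\<^sup>2) / b\<^sup>2 - \<theta>\<^sup>2 / 4 / b\<^sup>2"
        unfolding C \<eta>_def by (simp add: power_divide)
      then show ?thesis unfolding diff_divide_distrib[symmetric] by simp
    qed
    moreover have "y - z * (\<phi> / \<eta>) = b * (y / b - z * (\<theta> / b))"
      using b1 theta_pos by (simp add: \<eta>_def \<phi>_def power2_eq_square field_simps)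
    ultimately have "(C - \<eta>\<^sup>2 / 4) * (y - z * (\<phi> / \<eta>))\<^sup>2
        = (3 * r * b + 3 * \<theta>\<^sup>2 / 4) * (y / b - z * (\<theta> / b))\<^sup>2"
      using b1 by (simp add: power_mult_distrib)
    then show "(x - y * \<eta> / 2 - z * (3 * real_of_int r + \<phi> / 2))\<^sup>2
        + (C - \<eta>\<^sup>2 / 4) * (y - z * (\<phi> / \<eta>))\<^sup>2 \<le> C"
      using c unfolding conj_form_div_b by (simp add: \<eta>_def \<phi>_def)
  qed
  then show ?thesis using theta_pos unfolding v abs_mult eps_eq
    by (simp add: \<eta>_def power2_eq_square power3_eq_cube)
qed

lemma norm_theta: "\<theta> * Q \<theta> = b" and norm_theta2: "\<theta>\<^sup>2 * Q (\<theta>\<^sup>2) = b\<^sup>2"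
  using theta_pos by (simp_all add: Q_theta Q_theta2 power_divide)

lemma field_norms:
  "field_norm K 1 = 1" "field_norm K \<theta> = b" "field_norm K (\<theta>\<^sup>2) = b\<^sup>2" "field_norm K \<epsilon> = 1"
  using field_norm_eq[OF K_closed(2)] field_norm_eq[OF theta_in_K] field_norm_eq[OF O_sub_K[OF theta2_in_O]]
    field_norm_eq[OF O_sub_K[OF eps_in_O]] norm_theta norm_theta2 unit_norm_1[OF eps_unit eps_bounds(1)]
    conj_prod_1 by simp_all

lemma dpf_theta:
  assumes b: "b \<ge> 2"
  shows "diff_principal_factor K \<theta>"
proof (rule dpf_of_primitive)
  show "\<theta> \<notin> U" using unit_norm_1[of \<theta>] theta_pos norm_theta b by auto
  show "\<theta> ^ 3 / field_norm K \<theta> \<in> U"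
    using eps_unit unfolding field_norms eps_eq .
  fix c assume "of_rat c * \<theta> \<in> \<O>"
  then obtain x y z where "of_rat c * \<theta> = int_quad x y z" using O_eq by blast
  then have "quad (0, c, 0) \<theta> = int_quad x y z" by (simp add: quad_def)
  then show "c \<in> \<int>" unfolding quad_inject by simp
qed (use theta_in_O theta_pos in auto)

lemma dpf_theta2:
  assumes b: "b \<ge> 2"
  shows "diff_principal_factor K (\<theta>\<^sup>2)"
proof (rule dpf_of_primitive)
  have "real_of_int b * b \<noteq> 1" using mult_mono[of 2 "real_of_int b" 2 b] b by simp
  then show "\<theta>\<^sup>2 \<notin> U" using unit_norm_1[of "\<theta>\<^sup>2"] theta_pos norm_theta2 by (auto simp: power2_eq_square)
  have "(\<theta>\<^sup>2) ^ 3 / field_norm K (\<theta>\<^sup>2) = \<epsilon> * \<epsilon>"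
    unfolding field_norms eps_eq by (simp add: power2_eq_square power3_eq_cube mult_ac)
  then show "(\<theta>\<^sup>2) ^ 3 / field_norm K (\<theta>\<^sup>2) \<in> U" using unit_mult eps_unit by metis
  fix c assume "of_rat c * \<theta>\<^sup>2 \<in> \<O>"
  then obtain x y z where "of_rat c * \<theta>\<^sup>2 = int_quad x y z" using O_eq by blast
  then have "quad (0, 0, c) \<theta> = int_quad x y z" by (simp add: quad_def)
  then show "c \<in> \<int>" unfolding quad_inject by simp
qed (use theta2_in_O theta_pos in auto)

lemma powers_ordered: "\<theta> < 1" "\<theta>\<^sup>2 < \<theta>" "\<epsilon> = \<theta>\<^sup>2 * (\<theta> / b)" "\<epsilon> < \<theta>\<^sup>2"
proof -
  show "\<theta> < 1" using theta_le by simp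
  then show "\<theta>\<^sup>2 < \<theta>" using theta_pos by (simp add: power2_eq_square)
  show e: "\<epsilon> = \<theta>\<^sup>2 * (\<theta> / b)" unfolding eps_eq by (simp add: power2_eq_square power3_eq_cube)
  have "\<theta> / b < 1" using r_b_real \<open>\<theta> < 1\<close> by simp
  then have "\<theta>\<^sup>2 * (\<theta> / b) < \<theta>\<^sup>2 * 1" using theta_pos by (intro mult_strict_left_mono) auto
  then show "\<epsilon> < \<theta>\<^sup>2" unfolding e by simp
qed

lemmas gap_below_1 = gap_criterion[OF theta_in_O theta_pos powers_ordered(1) gap_1_theta]

lemma two_term_chain:
  assumes b: "b > 3 * r"
  shows "next_minimum K 1 = \<theta>" "next_minimum K \<theta> = \<epsilon>" "fundamental_unit K \<epsilon>"
    "period_length K = 2" "M_chain 1 K" "\<forall>\<alpha>\<in>Mins. \<alpha> \<notin> U \<longrightarrow> diff_principal_factor K \<alpha>"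
proof -
  have b2: "b \<ge> 2" using b r_ge_1 by simp
  have lt: "\<epsilon> < \<theta>" using powers_ordered by simp
  note gap2 = gap_criterion[OF eps_in_O eps_bounds(1) lt gap_theta_eps[OF b]]
  show "next_minimum K 1 = \<theta>" using next_minimum_eq[OF gap_below_1(1) powers_ordered(1) gap_below_1(2)] .
  show "next_minimum K \<theta> = \<epsilon>" using next_minimum_eq[OF gap2(1) lt gap2(2)] .
  have S: "Mins \<inter> {\<epsilon><..1} = {1, \<theta>}"
  proof (intro equalityI subsetI)
    fix \<gamma> assume g: "\<gamma> \<in> Mins \<inter> {\<epsilon><..1}"
    then have "\<gamma> \<notin> {\<theta><..<1}" "\<gamma> \<notin> {\<epsilon><..<\<theta>}" using gap_below_1(2) gap2(2) by blast+
    then show "\<gamma> \<in> {1, \<theta>}" using g by auto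
  qed (use one_in_Mins gap_below_1(1) eps_bounds lt powers_ordered in auto)
  have card: "card {1, \<theta>} = 2" "(2::nat) - 1 = 1" using powers_ordered(1) by simp_all
  have fin: "finite {1, \<theta>}" by simp
  have inj: "inj_on (\<lambda>\<alpha>. \<alpha> * Q \<alpha>) {1, \<theta>}"
    using b2 norm_theta conj_prod_1 by (auto simp: inj_on_def)
  have d: "\<forall>s\<in>{1, \<theta>}. s \<noteq> 1 \<longrightarrow> diff_principal_factor K s"
    using dpf_theta[OF b2] by auto
  note c = voronoi_chain[OF eps_unit eps_bounds S fin inj d]
  show "fundamental_unit K \<epsilon>" "period_length K = 2" "M_chain 1 K"
    "\<forall>\<alpha>\<in>Mins. \<alpha> \<notin> U \<longrightarrow> diff_principal_factor K \<alpha>"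
    using c unfolding card .
qed

lemma three_term_chain:
  assumes b: "b \<ge> 2" "b \<le> 3 * r"
  shows "next_minimum K 1 = \<theta>" "next_minimum K \<theta> = \<theta>\<^sup>2" "next_minimum K (\<theta>\<^sup>2) = \<epsilon>"
    "fundamental_unit K \<epsilon>" "period_length K = 3" "M_chain 2 K"
    "\<forall>\<alpha>\<in>Mins. \<alpha> \<notin> U \<longrightarrow> diff_principal_factor K \<alpha>"
proof -
  have "0 < \<theta>\<^sup>2" using theta_pos by simp
  note gap2 = gap_criterion[OF theta2_in_O this powers_ordered(2) gap_theta_theta2[OF b]]
  note gap3 = gap_criterion[OF eps_in_O eps_bounds(1) powers_ordered(4) gap_theta2_eps[OF b(2)]]
  show "next_minimum K 1 = \<theta>" using next_minimum_eq[OF gap_below_1(1) powers_ordered(1) gap_below_1(2)] .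
  show "next_minimum K \<theta> = \<theta>\<^sup>2" using next_minimum_eq[OF gap2(1) powers_ordered(2) gap2(2)] .
  show "next_minimum K (\<theta>\<^sup>2) = \<epsilon>" using next_minimum_eq[OF gap3(1) powers_ordered(4) gap3(2)] .
  have S: "Mins \<inter> {\<epsilon><..1} = {1, \<theta>, \<theta>\<^sup>2}"
  proof (intro equalityI subsetI)
    fix \<gamma> assume g: "\<gamma> \<in> Mins \<inter> {\<epsilon><..1}"
    then have "\<gamma> \<notin> {\<theta><..<1}" "\<gamma> \<notin> {\<theta>\<^sup>2<..<\<theta>}" "\<gamma> \<notin> {\<epsilon><..<\<theta>\<^sup>2}"
      using gap_below_1(2) gap2(2) gap3(2) by blast+
    then show "\<gamma> \<in> {1, \<theta>, \<theta>\<^sup>2}" using g by auto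
  next
    fix \<gamma> assume "\<gamma> \<in> {1, \<theta>, \<theta>\<^sup>2}"
    then consider "\<gamma> = 1" | "\<gamma> = \<theta>" | "\<gamma> = \<theta>\<^sup>2" by blast
    then show "\<gamma> \<in> Mins \<inter> {\<epsilon><..1}"
      by cases (use one_in_Mins gap_below_1(1) gap2(1) eps_bounds powers_ordered in simp_all)
  qed
  have neq: "\<theta> \<noteq> 1" "\<theta>\<^sup>2 \<noteq> 1" "\<theta> \<noteq> \<theta>\<^sup>2" using powers_ordered by auto
  then have card: "card {1, \<theta>, \<theta>\<^sup>2} = 3" "(3::nat) - 1 = 2" using neq[symmetric] by auto
  have "real_of_int b \<noteq> 1" "real_of_int b * b \<noteq> 1" "real_of_int b * b \<noteq> b"
    using mult_mono[of 2 "real_of_int b" 2 b] b by simp_all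
  then have inj: "inj_on (\<lambda>\<alpha>. \<alpha> * Q \<alpha>) {1, \<theta>, \<theta>\<^sup>2}"
    unfolding inj_on_def using norm_theta norm_theta2 conj_prod_1
    by (auto simp: power2_eq_square[of "real_of_int b"])
  have d: "\<forall>s\<in>{1, \<theta>, \<theta>\<^sup>2}. s \<noteq> 1 \<longrightarrow> diff_principal_factor K s"
    using dpf_theta[OF b(1)] dpf_theta2[OF b(1)] by auto
  have fin: "finite {1, \<theta>, \<theta>\<^sup>2}" by simp
  note c = voronoi_chain[OF eps_unit eps_bounds S fin inj d]
  show "fundamental_unit K \<epsilon>" "period_length K = 3" "M_chain 2 K"
    "\<forall>\<alpha>\<in>Mins. \<alpha> \<notin> U \<longrightarrow> diff_principal_factor K \<alpha>"
    using c unfolding card .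
qed

text \<open>For \<open>b = 1\<close> the gap below 1 is already a full period, and the gaps below \<open>\<theta>\<close> and \<open>\<theta>\<^sup>2\<close> are its
  images under multiplication by the unit \<open>\<theta>\<close>.\<close>

lemma one_term_chain:
  assumes b: "b = 1"
  shows "next_minimum K 1 = \<theta>" "next_minimum K \<theta> = \<theta>\<^sup>2" "next_minimum K (\<theta>\<^sup>2) = \<epsilon>" "\<epsilon> = \<theta> ^ 3"
    "fundamental_unit K \<theta>" "period_length K = 1" "M_chain 0 K"
    "\<forall>\<alpha>\<in>Mins. \<alpha> \<notin> U \<longrightarrow> diff_principal_factor K \<alpha>"
proof -
  have u: "\<theta> \<in> U"
  proof -
    have "int_quad (3 * r) 0 1 \<in> \<O>" using O_eq by blast
    moreover have "\<theta> * int_quad (3 * r) 0 1 = 1" using inverse_theta unfolding int_quad by (simp add: b)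
    ultimately show ?thesis unfolding unit_group_def using theta_in_O by blast
  qed
  show e: "\<epsilon> = \<theta> ^ 3" using theta_cube b by simp
  have pw: "\<theta> * \<theta> = \<theta>\<^sup>2" "\<theta> * \<theta>\<^sup>2 = \<epsilon>" by (simp_all add: e power2_eq_square power3_eq_cube)
  note gap2 = gap_scale[OF u theta_pos gap_below_1(2), unfolded pw mult_1_right]
  note gap3 = gap_scale[OF u theta_pos gap2, unfolded pw]
  have m: "\<theta>\<^sup>2 \<in> Mins" "\<epsilon> \<in> Mins"
    using unit_in_Mins[OF unit_mult[OF u u]] unit_in_Mins[OF eps_unit] theta_pos eps_bounds
    by (simp_all add: pw)
  show "next_minimum K 1 = \<theta>" using next_minimum_eq[OF gap_below_1(1) powers_ordered(1) gap_below_1(2)] .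
  show "next_minimum K \<theta> = \<theta>\<^sup>2" using next_minimum_eq[OF m(1) powers_ordered(2) gap2] .
  show "next_minimum K (\<theta>\<^sup>2) = \<epsilon>" using next_minimum_eq[OF m(2) powers_ordered(4) gap3] .
  have S: "Mins \<inter> {\<theta><..1} = {1}"
  proof (intro equalityI subsetI)
    fix \<gamma> assume g: "\<gamma> \<in> Mins \<inter> {\<theta><..1}"
    then have "\<gamma> \<notin> {\<theta><..<1}" using gap_below_1(2) by blast
    then show "\<gamma> \<in> {1}" using g by auto
  qed (use one_in_Mins powers_ordered in auto)
  have card: "card {1::real} = 1" "(1::nat) - 1 = 0" by simp_all
  have inj: "inj_on (\<lambda>\<alpha>. \<alpha> * Q \<alpha>) {1}" by simp
  have fin: "finite {1::real}" by simp
  have d: "\<forall>s\<in>{1}. s \<noteq> 1 \<longrightarrow> diff_principal_factor K s" by simp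
  note c = voronoi_chain[OF u theta_pos powers_ordered(1) S fin inj d]
  show "fundamental_unit K \<theta>" "period_length K = 1" "M_chain 0 K"
    "\<forall>\<alpha>\<in>Mins. \<alpha> \<notin> U \<longrightarrow> diff_principal_factor K \<alpha>"
    using c unfolding card .
qed

end

theorem theorem6:
  fixes r b :: int and P :: "int poly" and \<theta> :: real and L :: "real set"
  assumes "r \<ge> 1" and "b \<ge> 1" and "squarefree b"
    and P: "P = [:- b, 3 * r * b, 0, 1:]"
    and \<theta>: "poly (map_poly of_int P) \<theta> = 0"
    and "monogenic P \<theta>"
    and L: "L = rat_adjoin \<theta>"
  shows
    "(b \<ge> 2 \<longrightarrow>
        period_length L \<in> {2, 3} \<and>
        (r < \<lceil>real_of_int b / 3\<rceil> \<longrightarrow>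
           period_length L = 2 \<and> M_chain 1 L \<and>
           (next_minimum L ^^ 0) 1 = 1 \<and>
           (next_minimum L ^^ 1) 1 = \<theta> \<and>
           (next_minimum L ^^ 2) 1 = 1 - 3 * r * \<theta> \<and>
           field_norm L 1 = 1 \<and> field_norm L \<theta> = b \<and> field_norm L (1 - 3 * r * \<theta>) = 1 \<and>
           diff_principal_factor L \<theta> \<and>
           fundamental_unit L (1 - 3 * r * \<theta>) \<and> 0 < 1 - 3 * r * \<theta> \<and> 1 - 3 * r * \<theta> < 1) \<and>
        (r \<ge> \<lceil>real_of_int b / 3\<rceil> \<longrightarrow>
           period_length L = 3 \<and> M_chain 2 L \<and>
           (next_minimum L ^^ 0) 1 = 1 \<and>
           (next_minimum L ^^ 1) 1 = \<theta> \<and>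
           (next_minimum L ^^ 2) 1 = \<theta>\<^sup>2 \<and>
           (next_minimum L ^^ 3) 1 = 1 - 3 * r * \<theta> \<and>
           field_norm L 1 = 1 \<and> field_norm L \<theta> = b \<and> field_norm L (\<theta>\<^sup>2) = b\<^sup>2 \<and>
           field_norm L (1 - 3 * r * \<theta>) = 1 \<and>
           diff_principal_factor L \<theta> \<and> diff_principal_factor L (\<theta>\<^sup>2) \<and>
           fundamental_unit L (1 - 3 * r * \<theta>) \<and> 0 < 1 - 3 * r * \<theta> \<and> 1 - 3 * r * \<theta> < 1)) \<and>
     (b = 1 \<longrightarrow>
        period_length L = 1 \<and> M_chain 0 L \<and>
        (next_minimum L ^^ 0) 1 = 1 \<and>
        (next_minimum L ^^ 1) 1 = \<theta> \<and>
        fundamental_unit L \<theta> \<and> 0 < \<theta> \<and> \<theta> < 1 \<and>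
        (next_minimum L ^^ 2) 1 = \<theta>\<^sup>2 \<and>
        (next_minimum L ^^ 3) 1 = 1 - 3 * r * \<theta> \<and> 1 - 3 * r * \<theta> = \<theta> ^ 3 \<and>
        field_norm L 1 = 1 \<and> field_norm L \<theta> = 1 \<and> field_norm L (\<theta>\<^sup>2) = 1 \<and>
        field_norm L (1 - 3 * r * \<theta>) = 1) \<and>
     (period_length L \<in> {2, 3} \<longrightarrow>
        (\<forall>\<alpha>\<in>lattice_minima L. \<alpha> \<notin> unit_group L \<longrightarrow> diff_principal_factor L \<alpha>))"
proof -
  have eq: "\<theta> ^ 3 = real_of_int b - real_of_int (3 * r * b) * \<theta>"
    using \<theta> by (simp add: P map_poly_pCons power3_eq_cube algebra_simps)
  interpret cubic_family r b \<theta>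
  proof
    show "3 * r * b > 0" using assms(1,2) by simp
    show "irreducible (map_poly of_int [:- b, 3 * r * b, 0, 1:] :: rat poly)"
      "int_adjoin \<theta> = ring_of_integers (rat_adjoin \<theta>)"
      using \<open>monogenic P \<theta>\<close> unfolding monogenic_def P by blast+
  qed (use eq assms(1,2) in auto)
  have bound: "r < \<lceil>real_of_int b / 3\<rceil> \<longleftrightarrow> 3 * r < b"
    by (simp add: less_ceiling_iff field_simps) linarith
  then have bound': "\<lceil>real_of_int b / 3\<rceil> \<le> r \<longleftrightarrow> b \<le> 3 * r" by linarith
  have eps: "1 - 3 * real_of_int r * \<theta> = \<epsilon>" "1 - real_of_int (3 * r) * \<theta> = \<epsilon>"
    by (simp_all add: \<epsilon>_def)
  have iterates: "(f ^^ 0) x = x" "(f ^^ 1) x = f x" "(f ^^ 2) x = f (f x)" "(f ^^ 3) x = f (f (f x))"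
    for f :: "real \<Rightarrow> real" and x by (simp_all add: numeral_2_eq_2 numeral_3_eq_3)
  consider "b = 1" | "b \<ge> 2" "3 * r < b" | "b \<ge> 2" "b \<le> 3 * r" using \<open>b \<ge> 1\<close> by linarith
  then show ?thesis
  proof cases
    case 1
    then show ?thesis
      using one_term_chain[OF 1] field_norms theta_pos powers_ordered(1) unfolding L eps bound bound' iterates by simp
  next
    case 2
    then show ?thesis
      using two_term_chain[OF 2(2)] field_norms eps_bounds dpf_theta unfolding L eps bound bound' iterates by simp
  next
    case 3
    then show ?thesis
      using three_term_chain[OF 3] field_norms eps_bounds dpf_theta dpf_theta2
      unfolding L eps bound bound' iterates by simp
  qed
qed

end
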